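(* Let $f(z,t)$ be a one-parameter family of elliptic functions of order $n\ge 2$, with periods $\omega_1(t)\equiv 1$ and $\omega_2(t)$, with a single pole (mod periods) at the origin and with only simple critical points $a_0(t),\dots,a_n(t)$, as described in the context, and let $A_k(t)=f(a_k(t),t)$, with $A_0(t)\equiv 0$. Then $f$ satisfies the partial differential equation $$\frac{\dot f(z,t)}{f'(z,t)}=h(z,t),\qquad h(z,t)=\sum_{j=1}^{n}\gamma_j(t)\bigl[\zeta(z-a_j(t))+\zeta(a_j(t))-\eta_1(t)z\bigr],$$ where $$\gamma_k(t)=\frac{\dot A_k(t)}{D_k(t)},\qquad D_k(t)=c(t)\,\frac{\prod_{0\le j\le n,\ j\ne k}\sigma(a_k(t)-a_j(t))}{\sigma^{n+1}(a_k(t))},\qquad 1\le k\le n .$$ Moreover, the period $\omega_1(t)$ equals $1$, and the period $\omega_2(t)$ satisfies the differential equation $$\dot\omega_2(t)=2\pi i\sum_{j=1}^{n}\gamma_j(t).$$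
   Context: A dot denotes differentiation with respect to the real parameter $t$, a prime denotes $\partial/\partial z$. Weierstrass functions. For periods $\omega_1,\omega_2$ with $\operatorname{Im}(\omega_2/\omega_1)>0$ and lattice $\{m_1\omega_1+m_2\omega_2: m_1,m_2\in\mathbb{Z}\}$, $\sigma(z)=z\prod'\bigl(1-\tfrac{z}{\omega}\bigr)e^{z/\omega+z^2/(2\omega^2)}$ and $\zeta(z)=\sigma'(z)/\sigma(z)$, the product being over nonzero lattice points $\omega$; $\eta_k=2\zeta(\omega_k/2)$, so $\zeta(z+\omega_k)=\zeta(z)+\eta_k$. Here all these functions and $\eta_1(t)$ are formed with the periods $\omega_1(t)\equiv 1$ and $\omega_2(t)$. Setting. For each $t$ in a real interval, $f(\cdot,t)$ is an elliptic function of order $n$ (number of poles in a period parallelogram counted with multiplicity) with periods $\omega_1(t)\equiv1$ and $\omega_2(t)$, $\operatorname{Im}\omega_2(t)>0$. The family depends smoothly on $t$. For each $t$, the only pole of $f(\cdot,t)$ modulo the lattice is at $z=0$ (hence of order $n$), and all critical points of $f(\cdot,t)$ are simple. The functions $a_0(t),\dots,a_n(t)$ (smooth in $t$) form a complete system of representatives modulo the lattice of the critical points, chosen so that $\sum_{k=0}^n a_k(t)=0$, and $$f'(z,t)=c(t)\,\frac{\prod_{k=0}^n\sigma(z-a_k(t))}{\sigma^{n+1}(z)}$$ with $c(t)\neq 0$. The family is normalized by $A_0(t)=f(a_0(t),t)\equiv 0$. *)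

theory Defs
  imports "HOL-Complex_Analysis.Complex_Analysis"
begin

section \<open>Weierstrass functions with periods \<open>w1\<close>, \<open>w2\<close>\<close>

definition period_lattice :: "complex \<Rightarrow> complex \<Rightarrow> complex set" where
  "period_lattice w1 w2 = {of_int m1 * w1 + of_int m2 * w2 | m1 m2 :: int. True}"

text \<open>The infinite product is the unconditional one: the limit of the products over finite sets
  of nonzero lattice points, ordered by inclusion.\<close>

definition weierstrass_sigma :: "complex \<Rightarrow> complex \<Rightarrow> complex \<Rightarrow> complex" where
  "weierstrass_sigma w1 w2 z =
     z * Lim (finite_subsets_at_top (period_lattice w1 w2 - {0}))
           (\<lambda>X. \<Prod>w\<in>X. (1 - z / w) * exp (z / w + z\<^sup>2 / (2 * w\<^sup>2)))"

definition weierstrass_zeta :: "complex \<Rightarrow> complex \<Rightarrow> complex \<Rightarrow> complex" where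
  "weierstrass_zeta w1 w2 z = deriv (weierstrass_sigma w1 w2) z / weierstrass_sigma w1 w2 z"

definition weierstrass_eta1 :: "complex \<Rightarrow> complex \<Rightarrow> complex" where
  "weierstrass_eta1 w1 w2 = 2 * weierstrass_zeta w1 w2 (w1 / 2)"


section \<open>Elliptic functions\<close>

text \<open>The predicate \<^const>\<open>nicely_meromorphic_on\<close> fixes the value at a pole to be \<open>0\<close> and excludes
  removable singularities, so the periodicity equations can be imposed at every point.\<close>

definition elliptic :: "complex \<Rightarrow> complex \<Rightarrow> (complex \<Rightarrow> complex) \<Rightarrow> bool" where
  "elliptic w1 w2 f \<longleftrightarrow>
     f nicely_meromorphic_on UNIV \<and> (\<forall>z. f (z + w1) = f z) \<and> (\<forall>z. f (z + w2) = f z)"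

definition period_parallelogram :: "complex \<Rightarrow> complex \<Rightarrow> complex set" where
  "period_parallelogram w1 w2 =
     {of_real x * w1 + of_real y * w2 | x y :: real. 0 \<le> x \<and> x < 1 \<and> 0 \<le> y \<and> y < 1}"

definition elliptic_order :: "complex \<Rightarrow> complex \<Rightarrow> (complex \<Rightarrow> complex) \<Rightarrow> nat" where
  "elliptic_order w1 w2 f =
     (\<Sum>z | z \<in> period_parallelogram w1 w2 \<and> is_pole f z. nat (- zorder f z))"

definition critical_point :: "(complex \<Rightarrow> complex) \<Rightarrow> complex \<Rightarrow> bool" where
  "critical_point f z \<longleftrightarrow> \<not> is_pole f z \<and> deriv f z = 0"

definition simple_critical_point :: "(complex \<Rightarrow> complex) \<Rightarrow> complex \<Rightarrow> bool" where
  "simple_critical_point f z \<longleftrightarrow> critical_point f z \<and> zorder (deriv f) z = 1"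


section \<open>Smooth functions\<close>

text \<open>Real differentiability of class $C^k$ and $C^\infty$ on a set \<open>U\<close> that need not be open.
  Derivatives are taken within \<open>U\<close>, hence are one-sided at the end points of an interval.
  The sets in question, relatively open subsets of \<open>\<complex> \<times> I\<close> or \<open>I\<close> for a nondegenerate interval
  \<open>I\<close>, have unique derivatives.\<close>

primrec Ck_on :: "nat \<Rightarrow> ('a::euclidean_space \<Rightarrow> 'b::real_normed_vector) \<Rightarrow> 'a set \<Rightarrow> bool" where
  "Ck_on 0 f U \<longleftrightarrow> continuous_on U f"
| "Ck_on (Suc k) f U \<longleftrightarrow>
     (\<exists>f'. (\<forall>x\<in>U. (f has_derivative f' x) (at x within U)) \<and> (\<forall>v. Ck_on k (\<lambda>x. f' x v) U))"

definition smooth_on :: "('a::euclidean_space \<Rightarrow> 'b::real_normed_vector) \<Rightarrow> 'a set \<Rightarrow> bool" where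
  "smooth_on f U \<longleftrightarrow> (\<forall>k. Ck_on k f U)"

end

theory Submission
  imports Defs
begin

text \<open>
  Write \<open>f_t\<close> for the derivative of \<open>f\<close> in the parameter and consider \<open>q = f_t / f'\<close> as a function
  of \<open>z\<close> for fixed \<open>t\<close>. It is meromorphic, and everything about it can be read off.

  Differentiating the two identities \<open>f(z + 1, t) = f(z, t)\<close> and \<open>f(z + \<omega>2(t), t) = f(z, t)\<close> in \<open>t\<close>
  gives \<open>q(z + 1) = q(z)\<close> and \<open>q(z + \<omega>2) = q(z) - \<omega>2'\<close>. The pole of \<open>f_t\<close> at the origin has order at
  most \<open>n\<close>, while that of \<open>f'\<close> has order \<open>n + 1\<close>, so \<open>q\<close> vanishes at the lattice points up to the
  additive quasi-periods. The remaining singularities are the critical points \<open>a k\<close>; they are simple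
  zeros of \<open>f'\<close>, the second derivative of \<open>f\<close> there is \<open>D k\<close>, and \<open>f_t(a k) = A k'\<close> because the
  derivative of \<open>A k(t) = f(a k(t), t)\<close> loses its spatial part at a critical point. Hence \<open>q\<close> has at
  \<open>a k\<close> at most a simple pole, with residue \<open>\<gamma> k\<close>, and no pole at \<open>a 0\<close> since \<open>A 0 = 0\<close>.

  Therefore \<open>q - (\<Sum>k. \<gamma> k * \<zeta>(z - a k))\<close> extends to an entire function with additive quasi-periods.
  Its derivative is entire and doubly periodic, hence constant by Liouville's theorem, so the function
  is affine. The period \<open>1\<close> determines the slope, the value \<open>0\<close> of \<open>q\<close> at the origin determines the
  constant term, and comparison with the period \<open>\<omega>2\<close> yields, by Legendre's relation
  \<open>\<eta>1 * \<omega>2 - \<eta>2 = 2 * pi * \<i>\<close>, the equation for \<open>\<omega>2'\<close>. This argument at a fixed parameter is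
  \<open>quotient_eq_zeta_sum\<close>.

  Two bodies of theory feed it. The first is the elementary theory of \<open>\<sigma>\<close> and \<open>\<zeta>\<close>, from the
  convergence of the product (\<open>sigma_factorization\<close>) to the quasi-periodicity of \<open>\<zeta>\<close>
  (\<open>zeta_quasiperiodic\<close>) and Legendre's relation (\<open>legendre_relation\<close>). The second is the regularity
  of the time derivative: \<open>f_t\<close> is holomorphic off the lattice (\<open>holomorphic_f_t\<close>), and its pole at
  the origin has order at most \<open>n\<close> (\<open>pole_order_f_t\<close>). The latter is not part of the hypotheses,
  as \<open>f\<close> is smooth only away from its poles; it follows from the maximum modulus principle.
\<close>

section \<open>The lattice generated by \<open>1\<close> and \<open>\<tau>\<close>\<close>

lemma summable_int_powr: "(\<lambda>m::int. (1 + \<bar>real_of_int m\<bar>) powr (-3/2)) summable_on UNIV"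
proof -
  have s: "summable (\<lambda>n::nat. real (Suc n) powr (-3/2))"
    by (subst summable_Suc_iff, subst summable_real_powr_iff) auto
  have nat: "(\<lambda>n::nat. (1 + real n) powr (-3/2)) summable_on UNIV"
    using s by (intro norm_summable_imp_summable_on) (simp add: add_ac)
  have "(\<lambda>m::int. (1 + \<bar>real_of_int m\<bar>) powr (-3/2)) summable_on range int"
    using nat by (subst summable_on_reindex) (auto simp: o_def)
  moreover have "(\<lambda>m::int. (1 + \<bar>real_of_int m\<bar>) powr (-3/2)) summable_on range (\<lambda>n. - int n)"
    using nat by (subst summable_on_reindex) (auto simp: o_def inj_def)
  ultimately have "(\<lambda>m::int. (1 + \<bar>real_of_int m\<bar>) powr (-3/2)) summable_on (range int \<union> range (\<lambda>n. - int n))"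
    by (rule summable_on_union)
  moreover have "range int \<union> range (\<lambda>n. - int n) = UNIV"
  proof (intro equalityI subsetI UnCI)
    fix x :: int assume "x \<notin> range (\<lambda>n. - int n)"
    thus "x \<in> range int" by (metis int_cases2 rangeI)
  qed auto
  ultimately show ?thesis by simp
qed

locale lattice_one_tau =
  fixes \<tau> :: complex
  assumes Im_tau: "Im \<tau> > 0"
begin

abbreviation lat :: "complex set" where "lat \<equiv> period_lattice 1 \<tau>"

lemma lat_iff: "z \<in> lat \<longleftrightarrow> (\<exists>m n :: int. z = of_int m + of_int n * \<tau>)"
  by (auto simp: period_lattice_def)

lemma of_real_coords_in_lat_iff:
  "of_real x + of_real y * \<tau> \<in> lat \<longleftrightarrow> x \<in> \<int> \<and> y \<in> \<int>"
proof
  assume "of_real x + of_real y * \<tau> \<in> lat"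
  then obtain m n :: int where eq: "of_real x + of_real y * \<tau> = of_int m + of_int n * \<tau>"
    by (auto simp: lat_iff)
  hence "y * Im \<tau> = of_int n * Im \<tau>" by (auto simp: complex_eq_iff)
  hence y: "y = of_int n" using Im_tau by simp
  moreover have "x = of_int m" using eq y by (auto simp: complex_eq_iff)
  ultimately show "x \<in> \<int> \<and> y \<in> \<int>" by simp
next
  assume "x \<in> \<int> \<and> y \<in> \<int>"
  then obtain m n where "x = of_int m" "y = of_int n" by (auto elim!: Ints_cases)
  thus "of_real x + of_real y * \<tau> \<in> lat"
    unfolding lat_iff by (intro exI[of _ m] exI[of _ n]) simp
qed

lemma lat_iff_coords: "z \<in> lat \<longleftrightarrow> Re z - Im z / Im \<tau> * Re \<tau> \<in> \<int> \<and> Im z / Im \<tau> \<in> \<int>"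
proof -
  have "z = of_real (Re z - Im z / Im \<tau> * Re \<tau>) + of_real (Im z / Im \<tau>) * \<tau>"
    using Im_tau by (auto simp: complex_eq_iff)
  thus ?thesis using of_real_coords_in_lat_iff by metis
qed

lemma lat_simps [simp]: "0 \<in> lat" "1 \<in> lat" "\<tau> \<in> lat"
  unfolding lat_iff
  by (rule exI[of _ 0], rule exI[of _ 0], simp)
     (rule exI[of _ 1], rule exI[of _ 0], simp, rule exI[of _ 0], rule exI[of _ 1], simp)

lemma lat_add: "z \<in> lat \<Longrightarrow> w \<in> lat \<Longrightarrow> z + w \<in> lat"
  unfolding lat_iff
proof (elim exE)
  fix m n m' n' :: int
  assume "z = of_int m + of_int n * \<tau>" "w = of_int m' + of_int n' * \<tau>"
  hence "z + w = of_int (m + m') + of_int (n + n') * \<tau>" by (simp add: algebra_simps)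
  thus "\<exists>m n. z + w = of_int m + of_int n * \<tau>" by blast
qed

lemma lat_uminus: "z \<in> lat \<Longrightarrow> - z \<in> lat"
  unfolding lat_iff
proof (elim exE)
  fix m n :: int
  assume "z = of_int m + of_int n * \<tau>"
  hence "-z = of_int (-m) + of_int (-n) * \<tau>" by (simp add: algebra_simps)
  thus "\<exists>m n. -z = of_int m + of_int n * \<tau>" by blast
qed

lemma lat_diff: "z \<in> lat \<Longrightarrow> w \<in> lat \<Longrightarrow> z - w \<in> lat"
  using lat_add[of z "-w"] lat_uminus[of w] by simp

lemma lat_add_cancel [simp]: "w \<in> lat \<Longrightarrow> z + w \<in> lat \<longleftrightarrow> z \<in> lat"
  using lat_add[of z w] lat_diff[of "z + w" w] by auto

lemma lat_diff_commute: "z - w \<in> lat \<longleftrightarrow> w - z \<in> lat"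
  using lat_uminus[of "z - w"] lat_uminus[of "w - z"] by auto

lemma lat_uminus_iff [simp]: "- z \<in> lat \<longleftrightarrow> z \<in> lat"
  using lat_uminus[of z] lat_uminus[of "-z"] by auto

text \<open>A constant of norm equivalence between the \<open>1\<close>-norm of the lattice coordinates and the absolute value.\<close>
definition latK :: real where "latK = 1 + (1 + norm \<tau>) / Im \<tau>"

lemma latK_pos: "latK > 0"
  using Im_tau by (simp add: latK_def add_pos_nonneg)

lemma coords_le_norm:
  fixes m n :: int
  shows "real_of_int (\<bar>m\<bar> + \<bar>n\<bar>) \<le> latK * norm (of_int m + of_int n * \<tau>)"
proof -
  define w where "w = of_int m + of_int n * \<tau>"
  have "\<bar>Im w\<bar> \<le> norm w" by (rule abs_Im_le_cmod)
  hence n: "\<bar>real_of_int n\<bar> * Im \<tau> \<le> norm w"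
    using Im_tau by (simp add: w_def abs_mult)
  hence n': "\<bar>real_of_int n\<bar> \<le> norm w / Im \<tau>" using Im_tau by (simp add: field_simps)
  have "\<bar>real_of_int m\<bar> = norm (w - of_int n * \<tau>)" by (simp add: w_def)
  also have "\<dots> \<le> norm w + \<bar>real_of_int n\<bar> * norm \<tau>"
    by (metis norm_triangle_ineq4 norm_mult norm_of_int)
  also have "\<dots> \<le> norm w + norm w / Im \<tau> * norm \<tau>"
    using n' by (intro add_left_mono mult_right_mono) auto
  finally have "\<bar>real_of_int m\<bar> + \<bar>real_of_int n\<bar> \<le> norm w + norm w / Im \<tau> * norm \<tau> + norm w / Im \<tau>"
    using n' by linarith
  also have "\<dots> = latK * norm w" using Im_tau by (simp add: latK_def field_simps)
  finally show ?thesis by (simp add: w_def)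
qed

lemma range_lat: "range (\<lambda>(m::int, n::int). of_int m + of_int n * \<tau>) = lat"
  by (rule set_eqI) (simp add: lat_iff image_iff split_paired_Ex)

lemma bij_lat: "bij_betw (\<lambda>(m::int, n::int). of_int m + of_int n * \<tau>) (UNIV - {(0, 0)}) (lat - {0})"
proof -
  have inj: "inj (\<lambda>(m::int, n::int). of_int m + of_int n * \<tau>)"
  proof (rule injI, clarify)
    fix m n m' n' :: int
    assume "of_int m + of_int n * \<tau> = of_int m' + of_int n' * \<tau>"
    hence "of_int (m - m') + of_int (n - n') * \<tau> = 0" by (simp add: algebra_simps)
    with coords_le_norm[of "m - m'" "n - n'"]
    have "real_of_int (\<bar>m - m'\<bar> + \<bar>n - n'\<bar>) \<le> 0" by simp
    hence "\<bar>m - m'\<bar> + \<bar>n - n'\<bar> \<le> 0" by linarith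
    thus "m = m' \<and> n = n'" by linarith
  qed
  show ?thesis
  proof (rule bij_betw_imageI)
    show "inj_on (\<lambda>(m::int, n::int). of_int m + of_int n * \<tau>) (UNIV - {(0, 0)})"
      using inj by (rule inj_on_subset) auto
    note range_lat
    moreover have "(\<lambda>(m::int, n::int). of_int m + of_int n * \<tau>) ` (UNIV - {(0, 0)}) =
      (\<lambda>(m::int, n::int). of_int m + of_int n * \<tau>) ` UNIV -
      (\<lambda>(m::int, n::int). of_int m + of_int n * \<tau>) ` {(0,0)}"
      by (rule image_set_diff[OF inj])
    ultimately show "(\<lambda>(m::int, n::int). of_int m + of_int n * \<tau>) ` (UNIV - {(0, 0)}) = lat - {0}"
      by simp
  qed
qed

lemma finite_lat: "finite {w \<in> lat. norm w \<le> r}"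
proof -
  define N where "N = \<lceil>latK * r\<rceil>"
  have "{w \<in> lat. norm w \<le> r} \<subseteq> (\<lambda>(m::int, n::int). of_int m + of_int n * \<tau>) ` ({-N..N} \<times> {-N..N})"
  proof clarify
    fix w assume w: "w \<in> lat" "norm w \<le> r"
    then obtain m n :: int where mn: "w = of_int m + of_int n * \<tau>" by (auto simp: lat_iff)
    have "real_of_int (\<bar>m\<bar> + \<bar>n\<bar>) \<le> latK * norm w" using coords_le_norm[of m n] mn by simp
    also have "\<dots> \<le> latK * r" using w latK_pos by (intro mult_left_mono) auto
    finally have "\<bar>m\<bar> + \<bar>n\<bar> \<le> N" unfolding N_def by linarith
    thus "w \<in> (\<lambda>(m::int, n::int). of_int m + of_int n * \<tau>) ` ({-N..N} \<times> {-N..N})"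
      using mn by (intro image_eqI[of _ _ "(m, n)"]) auto
  qed
  thus ?thesis by (rule finite_subset) auto
qed

text \<open>By the arithmetic-geometric mean inequality \<open>(1 + \<bar>m\<bar>) * (1 + \<bar>n\<bar>)\<close> is dominated by
  \<open>norm w ^ 2\<close>. The exponent \<open>3\<close> then leaves \<open>3/2 > 1\<close> for each of the two coordinates, and the double
  sum splits into a product of convergent single sums.\<close>
lemma summable_lat: "(\<lambda>w. 1 / norm w ^ 3) summable_on (lat - {0})"
proof -
  let ?g = "\<lambda>m::int. (1 + \<bar>real_of_int m\<bar>) powr (-3/2)"
  have "(\<lambda>(m, n). ?g m * ?g n) summable_on (UNIV \<times> UNIV)"
  proof (rule summable_on_SigmaI)
    fix m :: int
    show "((\<lambda>n. case (m, n) of (m, n) \<Rightarrow> ?g m * ?g n) has_sum ?g m * infsum ?g UNIV) UNIV"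
      using summable_int_powr by (auto intro!: has_sum_cmult_right)
  next
    show "(\<lambda>m. ?g m * infsum ?g UNIV) summable_on UNIV"
      using summable_int_powr by (rule summable_on_cmult_left)
  qed auto
  hence "(\<lambda>(m, n). ?g m * ?g n) summable_on (UNIV - {(0, 0)})"
    by (rule summable_on_subset_banach) auto
  hence "(\<lambda>x. (8 * latK ^ 3) * (case x of (m, n) \<Rightarrow> ?g m * ?g n)) summable_on (UNIV - {(0, 0)})"
    by (rule summable_on_cmult_right)
  hence "(\<lambda>x. 1 / norm (case x of (m::int, n::int) \<Rightarrow> of_int m + of_int n * \<tau>) ^ 3) summable_on (UNIV - {(0, 0)})"
  proof (rule summable_on_comparison_test)
    fix x :: "int \<times> int" assume x: "x \<in> UNIV - {(0, 0)}"
    obtain m n where mn: "x = (m, n)" by (cases x)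
    define w where "w = of_int m + of_int n * \<tau>"
    define a b where "a = 1 + \<bar>real_of_int m\<bar>" and "b = 1 + \<bar>real_of_int n\<bar>"
    have ab: "a \<ge> 1" "b \<ge> 1" by (auto simp: a_def b_def)
    have "1 \<le> \<bar>m\<bar> + \<bar>n\<bar>" using x mn by auto
    hence "1 \<le> real_of_int (\<bar>m\<bar> + \<bar>n\<bar>)" by linarith
    hence le: "a + b \<le> 3 * real_of_int (\<bar>m\<bar> + \<bar>n\<bar>)" by (simp add: a_def b_def)
    have "a * b \<le> ((a + b) / 2) ^ 2"
      using zero_le_power2[of "a - b"] by (simp add: power2_eq_square field_simps)
    also have "\<dots> \<le> (2 * (latK * norm w)) ^ 2"
      using le coords_le_norm[of m n] ab by (intro power_mono) (auto simp: w_def)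
    finally have "a * b \<le> (2 * (latK * norm w)) ^ 2" .
    hence le32: "(a * b) powr (3/2) \<le> ((2 * (latK * norm w)) ^ 2) powr (3/2)"
      using ab by (intro powr_mono2) auto
    have wpos: "norm w > 0"
      using \<open>1 \<le> real_of_int _\<close> coords_le_norm[of m n] latK_pos by (auto simp: w_def)
    have "(y ^ 2) powr (3/2) = y ^ 3" if "y > 0" for y :: real
    proof -
      have "y ^ 2 = y powr 2" using that by (simp flip: powr_numeral)
      hence "(y ^ 2) powr (3/2) = y powr 3" by (simp add: powr_powr)
      thus ?thesis using that by simp
    qed
    note this[of "2 * (latK * norm w)"]
    moreover have "2 * (latK * norm w) > 0" using latK_pos wpos by (intro mult_pos_pos) auto
    ultimately have "((2 * (latK * norm w)) ^ 2) powr (3/2) = (2 * (latK * norm w)) ^ 3"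
      by blast
    with le32 have *: "(a * b) powr (3/2) \<le> 8 * latK ^ 3 * norm w ^ 3"
      by (simp add: power_mult_distrib)
    have pos: "(a * b) powr (3/2) > 0" using ab by simp
    have "1 / norm w ^ 3 \<le> 8 * latK ^ 3 / (a * b) powr (3/2)"
      using * pos wpos by (simp add: field_simps)
    also have "\<dots> = 8 * latK ^ 3 * (?g m * ?g n)"
      using ab by (simp add: a_def b_def powr_mult powr_minus divide_simps powr_minus_divide)
    finally show "1 / norm (case x of (m::int, n::int) \<Rightarrow> of_int m + of_int n * \<tau>) ^ 3
      \<le> (8 * latK ^ 3) * (case x of (m, n) \<Rightarrow> ?g m * ?g n)"
      by (simp add: mn w_def)
  qed auto
  thus ?thesis
    by (subst summable_on_reindex_bij_betw[OF bij_lat, symmetric])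
qed

lemma not_islimpt_lat: "\<not> z islimpt lat"
proof
    assume "z islimpt lat"
    hence "infinite (lat \<inter> ball z 1)" by (simp add: islimpt_eq_infinite_ball)
    moreover have "lat \<inter> ball z 1 \<subseteq> {w \<in> lat. norm w \<le> norm z + 1}"
    proof clarify
      fix w assume "w \<in> ball z 1"
      thus "norm w \<le> norm z + 1"
        using norm_triangle_ineq2[of w z] by (simp add: dist_norm norm_minus_commute)
    qed
    ultimately show False using finite_lat finite_subset by blast
qed

lemma closed_subset_lat: "A \<subseteq> lat \<Longrightarrow> closed A"
  using not_islimpt_lat islimpt_subset by (metis closed_limpt)

lemma closed_lat: "closed lat" and countable_lat: "countable lat" and open_Compl_lat: "open (- lat)"
proof -
  show "closed lat" by (rule closed_subset_lat) simp
  thus "open (- lat)" by auto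
  show "countable lat" unfolding range_lat[symmetric] by (intro countable_image) auto
qed

lemma connected_Compl_lat: "connected (- lat)"
  using connected_open_diff_countable[OF _ open_UNIV connected_UNIV countable_lat]
  by (simp add: Compl_eq_Diff_UNIV)

end

section \<open>The sigma function\<close>

lemma higher_deriv_sum_on:
  assumes "finite X" "\<And>w. w \<in> X \<Longrightarrow> f w holomorphic_on A" "open A" "z \<in> A"
  shows "(deriv ^^ m) (\<lambda>z. \<Sum>w\<in>X. f w z) z = (\<Sum>w\<in>X. (deriv ^^ m) (f w) z)"
  using assms(1,2)
proof (induction rule: finite_induct)
  case (insert w X)
  have "(deriv ^^ m) (\<lambda>z. f w z + (\<Sum>w\<in>X. f w z)) z =
          (deriv ^^ m) (f w) z + (deriv ^^ m) (\<lambda>z. \<Sum>w\<in>X. f w z) z"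
    by (rule higher_deriv_add[where S = A]) (use insert assms in \<open>auto intro!: holomorphic_on_sum\<close>)
  thus ?case using insert by simp
qed simp

context lattice_one_tau
begin

definition sfac :: "complex \<Rightarrow> complex \<Rightarrow> complex" where
  "sfac w z = (1 - z / w) * exp (z / w + z\<^sup>2 / (2 * w\<^sup>2))"

definition zterm :: "complex \<Rightarrow> complex \<Rightarrow> complex" where
  "zterm w z = 1 / (z - w) + 1 / w + z / w\<^sup>2"

text \<open>For \<open>norm z \<le> R\<close> the factors of the product are split at \<open>norm w = 2 * R\<close>. Beyond that radius
  \<open>norm (z / w) \<le> 1 / 2\<close>, so that every factor stays away from the branch cut of the logarithm.\<close>
definition near :: "real \<Rightarrow> complex set" where "near R = {w \<in> lat - {0}. norm w \<le> 2 * R}"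
definition far :: "real \<Rightarrow> complex set" where "far R = {w \<in> lat - {0}. norm w > 2 * R}"

lemma near_far: "near R \<union> far R = lat - {0}" "near R \<inter> far R = {}"
  by (auto simp: near_def far_def)

lemma finite_near: "finite (near R)"
  by (rule finite_subset[OF _ finite_lat[of "2 * R"]]) (auto simp: near_def)

lemma sfac_eq_weierstrass_factor: "sfac w z = weierstrass_factor 2 (z / w)"
  by (simp add: sfac_def weierstrass_factor_def numeral_2_eq_2 sum.atLeast_Suc_atMost power_divide mult.commute)

lemma sfac_eq_0_iff: "w \<noteq> 0 \<Longrightarrow> sfac w z = 0 \<longleftrightarrow> z = w"
  by (auto simp: sfac_def)

lemma sfac_0 [simp]: "sfac w 0 = 1"
  by (simp add: sfac_def)

lemma holomorphic_sfac [holomorphic_intros]: "sfac w holomorphic_on A"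
proof (cases "w = 0")
  case False
  thus ?thesis unfolding sfac_def by (auto intro!: holomorphic_intros)
next
  case True
  thus ?thesis unfolding sfac_def by simp
qed

lemma has_field_derivative_sfac:
  assumes "w \<noteq> 0" "z \<noteq> w"
  shows "(sfac w has_field_derivative sfac w z * zterm w z) (at z)"
  unfolding sfac_def[abs_def] using assms
  by (auto intro!: derivative_eq_intros simp: zterm_def field_simps power2_eq_square)

lemma norm_sfac_minus_1_le:
  assumes "w \<in> far R" "norm z \<le> R"
  shows "norm (sfac w z - 1) \<le> 3 * R ^ 3 / norm w ^ 3" "norm (sfac w z - 1) < 1 / 2"
proof -
  have w: "norm w > 2 * R" "w \<noteq> 0" using assms by (auto simp: far_def)
  have R: "R \<ge> 0" using assms(2) norm_ge_zero order_trans by blast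
  have le: "norm (z / w) \<le> R / norm w" using assms(2) by (simp add: norm_divide divide_right_mono)
  also have "\<dots> \<le> 1 / 2" using w R by (simp add: field_simps)
  finally have "norm (z / w) \<le> 1 / 2" .
  hence "norm (sfac w z - 1) \<le> 3 * norm (z / w) ^ 3"
    using weierstrass_factor_bound[of "z / w" 2] by (simp add: sfac_eq_weierstrass_factor eval_nat_numeral)
  moreover have "norm (z / w) ^ 3 \<le> (R / norm w) ^ 3"
    using le by (intro power_mono) auto
  moreover have "norm (z / w) ^ 3 \<le> (1 / 2) ^ 3"
    using \<open>norm (z / w) \<le> 1 / 2\<close> by (intro power_mono) auto
  ultimately show "norm (sfac w z - 1) \<le> 3 * R ^ 3 / norm w ^ 3" "norm (sfac w z - 1) < 1 / 2"
    by (auto simp: power_divide eval_nat_numeral)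
qed

definition logfac :: "complex \<Rightarrow> complex \<Rightarrow> complex" where "logfac w z = Ln (sfac w z)"

lemma sfac_far:
  assumes "w \<in> far R" "norm z \<le> R"
  shows "sfac w z \<notin> \<real>\<^sub>\<le>\<^sub>0" "exp (logfac w z) = sfac w z" "norm (logfac w z) \<le> 6 * R ^ 3 / norm w ^ 3"
proof -
  note * = norm_sfac_minus_1_le[OF assms]
  have "Re (sfac w z - 1) > - 1"
    using *(2) abs_Re_le_cmod[of "sfac w z - 1"] by linarith
  hence "Re (sfac w z) > 0" by simp
  thus 1: "sfac w z \<notin> \<real>\<^sub>\<le>\<^sub>0" by (auto simp: complex_nonpos_Reals_iff)
  hence "sfac w z \<noteq> 0" by auto
  thus "exp (logfac w z) = sfac w z" by (simp add: logfac_def)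
  show "norm (logfac w z) \<le> 6 * R ^ 3 / norm w ^ 3"
    using norm_Ln_le[OF *(2)] *(1) by (simp add: logfac_def)
qed

lemma holomorphic_logfac:
  assumes "w \<in> far R"
  shows "logfac w holomorphic_on ball 0 R"
  unfolding logfac_def[abs_def] using sfac_far(1)[OF assms]
  by (auto intro!: holomorphic_intros)

lemma has_field_derivative_logfac:
  assumes "w \<in> far R" "z \<in> ball 0 R"
  shows "(logfac w has_field_derivative zterm w z) (at z)"
proof -
  have z: "norm z \<le> R" "w \<noteq> 0" using assms by (auto simp: far_def)
  have "norm z < norm w" using assms norm_ge_zero[of z] unfolding far_def mem_ball dist_0_norm mem_Collect_eq by linarith
  hence zw: "z \<noteq> w" by auto
  note * = sfac_far[OF assms(1) z(1)]
  have "((\<lambda>z. Ln (sfac w z)) has_field_derivative inverse (sfac w z) * (sfac w z * zterm w z)) (at z)"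
    by (rule DERIV_chain2[OF has_field_derivative_Ln has_field_derivative_sfac]) (use * z zw in auto)
  moreover have "sfac w z \<noteq> 0" using *(1) by auto
  hence "inverse (sfac w z) * (sfac w z * zterm w z) = zterm w z" by simp
  ultimately show ?thesis by (simp only: logfac_def[abs_def])
qed

definition logsum :: "real \<Rightarrow> complex \<Rightarrow> complex" where
  "logsum R z = (\<Sum>\<^sub>\<infinity>w\<in>far R. logfac w z)"

text \<open>The Weierstrass M-test over finite subsets ordered by inclusion. This mode of convergence is
  the one in the definition of \<open>\<sigma>\<close>, so no enumeration of the lattice is needed.\<close>
lemma uniform_limit_logsum:
  "uniform_limit (ball 0 R) (\<lambda>X z. \<Sum>w\<in>X. logfac w z) (logsum R) (finite_subsets_at_top (far R))"
  unfolding logsum_def[abs_def]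
proof (rule Weierstrass_m_test_general)
  fix w z :: complex assume "w \<in> far R" "z \<in> ball 0 R"
  thus "norm (logfac w z) \<le> 6 * R ^ 3 * (1 / norm w ^ 3)"
    using sfac_far(3)[of w R z] by simp
next
  have "(\<lambda>w. 1 / norm w ^ 3) summable_on far R"
    using summable_lat by (rule summable_on_subset_banach) (auto simp: far_def)
  thus "(\<lambda>w. 6 * R ^ 3 * (1 / norm w ^ 3)) summable_on far R"
    by (rule summable_on_cmult_right)
qed

lemma eventually_holomorphic_logsum:
  "eventually (\<lambda>X. (\<lambda>z. \<Sum>w\<in>X. logfac w z) holomorphic_on ball 0 R) (finite_subsets_at_top (far R))"
  by (rule eventually_finite_subsets_at_top_weakI)
     (auto intro!: holomorphic_intros holomorphic_on_sum dest: holomorphic_logfac)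

lemma holomorphic_logsum: "logsum R holomorphic_on ball 0 R"
  unfolding holomorphic_on_def
proof
  fix z :: complex assume z: "z \<in> ball 0 R"
  obtain r where r: "r > 0" "cball z r \<subseteq> ball 0 R"
    using z open_contains_cball[of "ball (0::complex) R"] open_ball by metis
  have "logsum R holomorphic_on ball z r"
  proof (rule holomorphic_uniform_limit)
    show "\<forall>\<^sub>F X in finite_subsets_at_top (far R).
       continuous_on (cball z r) (\<lambda>z. \<Sum>w\<in>X. logfac w z) \<and>
       (\<lambda>z. \<Sum>w\<in>X. logfac w z) holomorphic_on ball z r"
      using eventually_holomorphic_logsum
    proof eventually_elim
      case (elim X)
      have "ball z r \<subseteq> ball 0 R" using r ball_subset_cball by blast
      thus ?case using r elim by (meson holomorphic_on_imp_continuous_on holomorphic_on_subset)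
    qed
    show "uniform_limit (cball z r) (\<lambda>X z. \<Sum>w\<in>X. logfac w z) (logsum R) (finite_subsets_at_top (far R))"
      using uniform_limit_logsum r(2) by (rule uniform_limit_on_subset)
  qed auto
  thus "logsum R field_differentiable at z within ball 0 R"
    using r(1) by (meson centre_in_ball field_differentiable_at_within holomorphic_on_imp_differentiable_at open_ball)
qed

lemma has_sum_higher_deriv_logsum:
  assumes "z \<in> ball 0 R"
  shows "((\<lambda>w. (deriv ^^ m) (logfac w) z) has_sum (deriv ^^ m) (logsum R) z) (far R)"
proof -
  have "((\<lambda>X. (deriv ^^ m) (\<lambda>z. \<Sum>w\<in>X. logfac w z) z) \<longlongrightarrow> (deriv ^^ m) (logsum R) z) (finite_subsets_at_top (far R))"
    by (rule higher_deriv_complex_uniform_limit[OF uniform_limit_logsum eventually_holomorphic_logsum])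
       (use assms in auto)
  moreover have "\<forall>\<^sub>F X in finite_subsets_at_top (far R).
     (deriv ^^ m) (\<lambda>z. \<Sum>w\<in>X. logfac w z) z = (\<Sum>w\<in>X. (deriv ^^ m) (logfac w) z)"
    by (rule eventually_finite_subsets_at_top_weakI, rule higher_deriv_sum_on[OF _ _ open_ball assms])
       (use holomorphic_logfac in auto)
  ultimately show ?thesis
    unfolding has_sum_def by (blast intro: Lim_transform_eventually)
qed

abbreviation \<sigma> where "\<sigma> \<equiv> weierstrass_sigma 1 \<tau>"
abbreviation \<zeta> where "\<zeta> \<equiv> weierstrass_zeta 1 \<tau>"

text \<open>Only the far factors are taken through the logarithm. Every finite set of lattice points that
  contains the finitely many near ones contributes their product exactly, so the limit of the far part
  determines the limit of the whole product. The analytic properties of \<open>\<sigma>\<close> on the ball are then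
  those of a finite product times an exponential.\<close>
lemma sigma_factorization:
  assumes "z \<in> ball 0 R"
  shows "\<sigma> z = z * (\<Prod>w\<in>near R. sfac w z) * exp (logsum R z)"
proof -
  have "((\<lambda>X. \<Sum>w\<in>X. logfac w z) \<longlongrightarrow> logsum R z) (finite_subsets_at_top (far R))"
    using uniform_limit_logsum assms by (rule tendsto_uniform_limitI)
  hence "((\<lambda>X. exp (\<Sum>w\<in>X. logfac w z)) \<longlongrightarrow> exp (logsum R z)) (finite_subsets_at_top (far R))"
    by (rule tendsto_exp)
  moreover have "\<forall>\<^sub>F X in finite_subsets_at_top (far R). exp (\<Sum>w\<in>X. logfac w z) = (\<Prod>w\<in>X. sfac w z)"
    using assms by (intro eventually_finite_subsets_at_top_weakI)
      (auto simp: exp_sum intro!: prod.cong sfac_far(2))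
  ultimately have "((\<lambda>X. \<Prod>w\<in>X. sfac w z) \<longlongrightarrow> exp (logsum R z)) (finite_subsets_at_top (far R))"
    by (blast intro: Lim_transform_eventually)
  moreover have "filterlim (\<lambda>X. X \<inter> far R) (finite_subsets_at_top (far R)) (finite_subsets_at_top (lat - {0}))"
    unfolding filterlim_finite_subsets_at_top
  proof (intro allI impI)
    fix X assume "finite X \<and> X \<subseteq> far R"
    thus "\<forall>\<^sub>F y in finite_subsets_at_top (lat - {0}). finite (y \<inter> far R) \<and> X \<subseteq> y \<inter> far R \<and> y \<inter> far R \<subseteq> far R"
      unfolding eventually_finite_subsets_at_top by (intro exI[of _ X]) (auto simp: far_def)
  qed
  ultimately have "((\<lambda>X. \<Prod>w\<in>X \<inter> far R. sfac w z) \<longlongrightarrow> exp (logsum R z)) (finite_subsets_at_top (lat - {0}))"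
    by (rule filterlim_compose)
  hence "((\<lambda>X. (\<Prod>w\<in>near R. sfac w z) * (\<Prod>w\<in>X \<inter> far R. sfac w z)) \<longlongrightarrow>
          (\<Prod>w\<in>near R. sfac w z) * exp (logsum R z)) (finite_subsets_at_top (lat - {0}))"
    by (intro tendsto_intros)
  moreover have "\<forall>\<^sub>F X in finite_subsets_at_top (lat - {0}).
    (\<Prod>w\<in>near R. sfac w z) * (\<Prod>w\<in>X \<inter> far R. sfac w z) = (\<Prod>w\<in>X. sfac w z)"
    unfolding eventually_finite_subsets_at_top
  proof (intro exI[of _ "near R"] conjI allI impI)
    fix X assume X: "finite X \<and> near R \<subseteq> X \<and> X \<subseteq> lat - {0}"
    hence "X = near R \<union> (X \<inter> far R)" using near_far(1)[of R] by blast
    moreover have "(\<Prod>w\<in>near R \<union> (X \<inter> far R). sfac w z) =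
      (\<Prod>w\<in>near R. sfac w z) * (\<Prod>w\<in>X \<inter> far R. sfac w z)"
      using X near_far(2)[of R] finite_near by (intro prod.union_disjoint) auto
    ultimately show "(\<Prod>w\<in>near R. sfac w z) * (\<Prod>w\<in>X \<inter> far R. sfac w z) = (\<Prod>w\<in>X. sfac w z)"
      by simp
  qed (use finite_near near_far in auto)
  ultimately have "((\<lambda>X. \<Prod>w\<in>X. sfac w z) \<longlongrightarrow>
          (\<Prod>w\<in>near R. sfac w z) * exp (logsum R z)) (finite_subsets_at_top (lat - {0}))"
    by (rule Lim_transform_eventually)
  hence "Lim (finite_subsets_at_top (lat - {0})) (\<lambda>X. \<Prod>w\<in>X. sfac w z) =
           (\<Prod>w\<in>near R. sfac w z) * exp (logsum R z)"
    by (intro tendsto_Lim) auto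
  thus ?thesis by (simp add: weierstrass_sigma_def sfac_def mult.assoc)
qed

lemma holomorphic_sigma_ball: "\<sigma> holomorphic_on ball 0 R"
proof -
  have "(\<lambda>z. z * (\<Prod>w\<in>near R. sfac w z) * exp (logsum R z)) holomorphic_on ball 0 R"
    by (intro holomorphic_intros holomorphic_on_prod holomorphic_logsum)
  thus ?thesis
    by (subst holomorphic_cong[OF refl sigma_factorization]) auto
qed

lemma holomorphic_sigma [holomorphic_intros]: "\<sigma> holomorphic_on A"
proof -
  have "\<sigma> field_differentiable (at z)" for z
    using holomorphic_sigma_ball[of "norm z + 1"]
    by (auto simp: holomorphic_on_open field_differentiable_def)
  thus ?thesis by (auto simp: holomorphic_on_def intro: field_differentiable_at_within)
qed

lemma sigma_eq_0_iff: "\<sigma> z = 0 \<longleftrightarrow> z \<in> lat"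
proof -
  have "\<sigma> z = z * (\<Prod>w\<in>near (norm z + 1). sfac w z) * exp (logsum (norm z + 1) z)"
    by (rule sigma_factorization) auto
  hence "\<sigma> z = 0 \<longleftrightarrow> z = 0 \<or> (\<exists>w\<in>near (norm z + 1). sfac w z = 0)"
    using finite_near by simp
  also have "\<dots> \<longleftrightarrow> z \<in> lat" 
    by (auto simp: near_def sfac_eq_0_iff)
  finally show ?thesis .
qed

lemma sigma_0 [simp]: "\<sigma> 0 = 0"
  by (simp add: sigma_eq_0_iff)

lemma has_field_derivative_sigma_0: "(\<sigma> has_field_derivative 1) (at 0)"
proof -
  define g where "g = (\<lambda>z. (\<Prod>w\<in>near 1. sfac w z) * exp (logsum 1 z))"
  have "g holomorphic_on ball 0 1" unfolding g_def
    by (intro holomorphic_intros holomorphic_on_prod holomorphic_logsum)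
  moreover have "(0::complex) \<in> ball 0 1" by simp
  ultimately obtain g' where "(g has_field_derivative g') (at 0)"
    unfolding holomorphic_on_open[OF open_ball] by blast
  hence "((\<lambda>z. z * g z) has_field_derivative g 0) (at 0)"
    by (auto intro!: derivative_eq_intros)
  moreover have "logsum 1 0 = 0"
    by (simp add: logsum_def logfac_def)
  ultimately have "((\<lambda>z. z * g z) has_field_derivative 1) (at 0)"
    by (simp add: g_def)
  moreover have "\<sigma> z = z * g z" if "z \<in> ball 0 1" for z
    using sigma_factorization[OF that] by (simp add: g_def mult.assoc)
  ultimately show ?thesis
    by (subst DERIV_cong_ev[OF refl _ refl, of _ "\<lambda>z. z * g z"])
       (auto intro!: eventually_nhds_in_open[of "ball 0 1", THEN eventually_mono])
qed

end

section \<open>The zeta function\<close>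

lemma has_field_derivative_inverse_square:
  assumes "z \<noteq> w"
  shows "((\<lambda>z. - 1 / (z - w)\<^sup>2 + c) has_field_derivative 2 / (z - w) ^ 3) (at (z :: complex))"
proof -
  have "((\<lambda>u. - 1 / u\<^sup>2 + c) has_field_derivative 2 / u ^ 3) (at u)" if "u \<noteq> 0" for u :: complex
    using that by (auto intro!: derivative_eq_intros simp: field_simps eval_nat_numeral)
  moreover have "((\<lambda>z. z - w) has_field_derivative 1) (at z)"
    by (auto intro!: derivative_eq_intros)
  ultimately show ?thesis
    using DERIV_chain2[of "\<lambda>u. - 1 / u\<^sup>2 + c" _ "\<lambda>z. z - w" z 1] assms by simp
qed

context lattice_one_tau
begin

lemma zeta_eq_logderiv: "\<zeta> z = deriv \<sigma> z / \<sigma> z"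
  by (simp add: weierstrass_zeta_def)

lemma holomorphic_zeta: "\<zeta> holomorphic_on - lat"
  unfolding zeta_eq_logderiv[abs_def]
  using open_Compl_lat by (auto intro!: holomorphic_intros holomorphic_deriv simp: sigma_eq_0_iff)

lemma zeta_local:
  assumes "z \<in> ball 0 R" "z \<notin> lat"
  shows "\<zeta> z = 1 / z + (\<Sum>w\<in>near R. zterm w z) + deriv (logsum R) z"
proof -
  have z: "z \<noteq> 0" using assms by auto
  have nz: "z \<noteq> w" "w \<noteq> 0" if "w \<in> near R" for w using that assms by (auto simp: near_def)
  define P where "P = (\<lambda>X z. \<Prod>w\<in>X. sfac w z)"
  have P: "(P X has_field_derivative P X z * (\<Sum>w\<in>X. zterm w z)) (at z) \<and> P X z \<noteq> 0"
    if "finite X" "X \<subseteq> near R" for X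
    using that
  proof (induction rule: finite_induct)
    case (insert w X)
    have w: "w \<in> near R" using insert by auto
    have IH: "(P X has_field_derivative P X z * (\<Sum>w\<in>X. zterm w z)) (at z)" "P X z \<noteq> 0"
      using insert by auto
    have "((\<lambda>z. sfac w z * P X z) has_field_derivative
       (sfac w z * zterm w z) * P X z + (P X z * (\<Sum>w\<in>X. zterm w z)) * sfac w z) (at z)"
      by (rule DERIV_mult'[OF has_field_derivative_sfac IH(1), THEN DERIV_cong]) (use nz[OF w] in auto)
    moreover have "P (insert w X) = (\<lambda>z. sfac w z * P X z)"
      using insert by (simp add: P_def)
    ultimately show ?case
      using insert IH nz[OF w] by (simp add: algebra_simps sfac_eq_0_iff)
  qed (auto simp: P_def)
  note P = P[OF finite_near order_refl]
  have L: "(logsum R has_field_derivative deriv (logsum R) z) (at z)"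
    using holomorphic_derivI[OF holomorphic_logsum] assms by auto
  define g where "g = (\<lambda>z. z * P (near R) z * exp (logsum R z))"
  have "(g has_field_derivative
     g z * (1 / z + (\<Sum>w\<in>near R. zterm w z) + deriv (logsum R) z)) (at z)"
    unfolding g_def using P z
    by (auto intro!: derivative_eq_intros L simp: field_simps)
  moreover have "\<forall>\<^sub>F x in nhds z. \<sigma> x = g x"
    using eventually_nhds_in_open[OF open_ball assms(1)]
    by eventually_elim (auto simp: g_def P_def sigma_factorization)
  ultimately have "(\<sigma> has_field_derivative
     g z * (1 / z + (\<Sum>w\<in>near R. zterm w z) + deriv (logsum R) z)) (at z)"
    by (subst DERIV_cong_ev[OF refl _ refl])
  hence "deriv \<sigma> z = g z * (1 / z + (\<Sum>w\<in>near R. zterm w z) + deriv (logsum R) z)"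
    by (rule DERIV_imp_deriv)
  moreover have "\<sigma> z = g z" "g z \<noteq> 0"
    using P z sigma_factorization[OF assms(1)] by (auto simp: g_def P_def)
  ultimately show ?thesis by (simp add: zeta_eq_logderiv)
qed

lemma deriv_logfac_eq:
  assumes "w \<in> far R"
  shows "z \<in> ball 0 R \<Longrightarrow> deriv (logfac w) z = zterm w z"
  using has_field_derivative_logfac[OF assms] by (auto intro: DERIV_imp_deriv)

lemma has_sum_zeta:
  assumes "z \<notin> lat"
  shows "((\<lambda>w. zterm w z) has_sum (\<zeta> z - 1 / z)) (lat - {0})"
proof -
  define R where "R = norm z + 1"
  have z: "z \<in> ball 0 R" by (simp add: R_def)
  have "((\<lambda>w. (deriv ^^ 1) (logfac w) z) has_sum (deriv ^^ 1) (logsum R) z) (far R)"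
    by (rule has_sum_higher_deriv_logsum[OF z])
  hence "((\<lambda>w. zterm w z) has_sum deriv (logsum R) z) (far R)"
    by (subst has_sum_cong[OF deriv_logfac_eq[OF _ z, symmetric]]) auto
  moreover have "((\<lambda>w. zterm w z) has_sum (\<Sum>w\<in>near R. zterm w z)) (near R)"
    by (rule has_sum_finite[OF finite_near])
  ultimately have "((\<lambda>w. zterm w z) has_sum (\<Sum>w\<in>near R. zterm w z) + deriv (logsum R) z) (near R \<union> far R)"
    using near_far(2) by (intro has_sum_Un_disjoint)
  thus ?thesis using zeta_local[OF z assms] by (simp add: near_far)
qed

lemma zeta_minus: "\<zeta> (- z) = - \<zeta> z"
proof (cases "z \<in> lat")
  case True
  thus ?thesis using sigma_eq_0_iff[of z] sigma_eq_0_iff[of "-z"] by (simp add: zeta_eq_logderiv)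
next
  case False
  have "\<zeta> (-z) - 1 / (-z) = (\<Sum>\<^sub>\<infinity>w\<in>lat-{0}. zterm w (-z))"
    using has_sum_zeta[of "-z"] False by (simp add: infsumI)
  also have "\<dots> = (\<Sum>\<^sub>\<infinity>w\<in>lat-{0}. - zterm w z)"
  proof (rule infsum_reindex_bij_witness[of _ uminus uminus])
    fix w assume "w \<in> lat - {0}"
    have "1 / (z + w) = - (1 / (- z - w))"
      by (metis divide_minus_right minus_add_distrib minus_diff_eq add.commute diff_minus_eq_add uminus_add_conv_diff)
    thus "- zterm (-w) z = zterm w (-z)" by (simp add: zterm_def)
  qed auto
  also have "\<dots> = - (\<zeta> z - 1 / z)"
    using has_sum_zeta[OF False] by (simp add: infsum_uminus infsumI)
  finally show ?thesis by simp
qed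

lemma has_field_derivative_zterm:
  assumes "z \<noteq> w"
  shows "(zterm w has_field_derivative (- 1 / (z - w)\<^sup>2 + 1 / w\<^sup>2)) (at z)"
proof -
  have "((\<lambda>u. 1 / u) has_field_derivative - 1 / u\<^sup>2) (at u)" if "u \<noteq> 0" for u :: complex
    using that by (auto intro!: derivative_eq_intros simp: field_simps power2_eq_square)
  moreover have "((\<lambda>z. z - w) has_field_derivative 1) (at z)"
    by (auto intro!: derivative_eq_intros)
  ultimately have "((\<lambda>z. 1 / (z - w)) has_field_derivative - 1 / (z - w)\<^sup>2) (at z)"
    using DERIV_chain2[of "\<lambda>u. 1 / u" _ "\<lambda>z. z - w" z 1] assms by simp
  moreover have "((\<lambda>z. 1 / w + z / w\<^sup>2) has_field_derivative 0 + 1 / w\<^sup>2) (at z)"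
    by (intro DERIV_add DERIV_const DERIV_cdivide DERIV_ident)
  ultimately have "((\<lambda>z. 1 / (z - w) + (1 / w + z / w\<^sup>2)) has_field_derivative
      (- 1 / (z - w)\<^sup>2 + (0 + 1 / w\<^sup>2))) (at z)"
    by (rule DERIV_add)
  thus ?thesis by (simp add: zterm_def[abs_def] add.assoc)
qed

lemma zterm_deriv2:
  assumes "z \<noteq> w"
  shows "deriv (deriv (zterm w)) z = 2 / (z - w) ^ 3"
proof -
  have op: "open (- {w})" by auto
  have "\<forall>\<^sub>F x in nhds z. deriv (zterm w) x = - 1 / (x - w)\<^sup>2 + 1 / w\<^sup>2"
    using eventually_nhds_in_open[OF op, of z] assms
    by (auto elim!: eventually_mono intro!: DERIV_imp_deriv has_field_derivative_zterm[THEN DERIV_cong])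
  hence "deriv (deriv (zterm w)) z = deriv (\<lambda>x. - 1 / (x - w)\<^sup>2 + 1 / w\<^sup>2) z"
    by (rule deriv_cong_ev) simp
  also have "\<dots> = 2 / (z - w) ^ 3"
    by (rule DERIV_imp_deriv, rule has_field_derivative_inverse_square) fact
  finally show ?thesis .
qed

text \<open>Two differentiations make the convergence so fast that the correction terms
  \<open>1 / w + z / w\<^sup>2\<close> of \<open>zterm\<close> disappear, and the sum extends over the whole lattice. In this form
  it is invariant under translation of the lattice.\<close>
lemma has_sum_zeta_deriv2:
  assumes "z \<notin> lat"
  shows "((\<lambda>w. 2 / (z - w) ^ 3) has_sum deriv (deriv \<zeta>) z) lat"
proof -
  define R where "R = norm z + 1"
  define U where "U = ball 0 R - lat"
  have d2: "(deriv ^^ 2) g = deriv (deriv g)" for g :: "complex \<Rightarrow> complex"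
    by (simp add: numeral_2_eq_2)
  have d3: "(deriv ^^ 3) g = deriv (deriv (deriv g))" for g :: "complex \<Rightarrow> complex"
    by (simp add: numeral_3_eq_3)
  have z: "z \<in> ball 0 R" by (simp add: R_def)
  have U: "open U" "z \<in> U" unfolding U_def using assms closed_lat z by (auto intro!: open_Diff)
  have near: "zterm w holomorphic_on U" if "w \<in> near R" for w
    using that U(1) unfolding holomorphic_on_open[OF U(1)]
    by (auto simp: near_def U_def intro!: exI has_field_derivative_zterm)
  have inv: "(\<lambda>z. 1 / z) holomorphic_on U"
    by (intro holomorphic_intros) (auto simp: U_def)
  have ls: "deriv (logsum R) holomorphic_on U"
    by (rule holomorphic_on_subset[of _ "ball 0 R"])
       (auto intro!: holomorphic_deriv holomorphic_logsum simp: U_def)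
  have "\<forall>\<^sub>F x in nhds z. \<zeta> x = (1 / x + (\<Sum>w\<in>near R. zterm w x)) + deriv (logsum R) x"
    using eventually_nhds_in_open[OF U]
    by eventually_elim (auto simp: U_def zeta_local)
  hence "(deriv ^^ 2) \<zeta> z = (deriv ^^ 2) (\<lambda>x. (1 / x + (\<Sum>w\<in>near R. zterm w x)) + deriv (logsum R) x) z"
    by (rule higher_deriv_cong_ev) simp
  also have "\<dots> = (deriv ^^ 2) (\<lambda>x. 1 / x + (\<Sum>w\<in>near R. zterm w x)) z + (deriv ^^ 2) (deriv (logsum R)) z"
    by (rule higher_deriv_add[OF _ ls U]) (use near inv in \<open>auto intro!: holomorphic_intros holomorphic_on_sum\<close>)
  also have "(deriv ^^ 2) (\<lambda>x. 1 / x + (\<Sum>w\<in>near R. zterm w x)) z =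
    (deriv ^^ 2) (\<lambda>x. 1 / x) z + (deriv ^^ 2) (\<lambda>x. \<Sum>w\<in>near R. zterm w x) z"
    by (rule higher_deriv_add[OF inv _ U]) (use near in \<open>auto intro!: holomorphic_on_sum\<close>)
  also have "(deriv ^^ 2) (\<lambda>x. \<Sum>w\<in>near R. zterm w x) z = (\<Sum>w\<in>near R. (deriv ^^ 2) (zterm w) z)"
    by (rule higher_deriv_sum_on[OF finite_near near U])
  also have "\<dots> = (\<Sum>w\<in>near R. 2 / (z - w) ^ 3)"
  proof (intro sum.cong refl)
    fix w assume "w \<in> near R"
    hence "z \<noteq> w" using assms by (auto simp: near_def)
    thus "(deriv ^^ 2) (zterm w) z = 2 / (z - w) ^ 3"
      by (simp add: d2 zterm_deriv2)
  qed
  also have "(deriv ^^ 2) (\<lambda>x. 1 / x) z = 2 / (z - 0) ^ 3"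
  proof -
    have *: "(\<lambda>x. 1 / x) = zterm 0" by (simp add: zterm_def fun_eq_iff)
    have "z \<noteq> 0" using assms by auto
    thus ?thesis unfolding * d2 by (rule zterm_deriv2)
  qed
  finally have eq: "deriv (deriv \<zeta>) z = 2 / (z - 0) ^ 3 + (\<Sum>w\<in>near R. 2 / (z - w) ^ 3) + (deriv ^^ 3) (logsum R) z"
    by (simp only: d2 d3)
  have "((\<lambda>w. (deriv ^^ 3) (logfac w) z) has_sum (deriv ^^ 3) (logsum R) z) (far R)"
    by (rule has_sum_higher_deriv_logsum[OF z])
  moreover have "(deriv ^^ 3) (logfac w) z = 2 / (z - w) ^ 3" if "w \<in> far R" for w
  proof -
    have "\<forall>\<^sub>F x in nhds z. deriv (logfac w) x = zterm w x"
      using eventually_nhds_in_open[OF open_ball z]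
      by eventually_elim (rule deriv_logfac_eq[OF that])
    hence "(deriv ^^ 2) (deriv (logfac w)) z = (deriv ^^ 2) (zterm w) z"
      by (rule higher_deriv_cong_ev) simp
    moreover have "z \<noteq> w" using that assms by (auto simp: far_def)
    note zterm_deriv2[OF this]
    ultimately show ?thesis by (simp only: d2 d3)
  qed
  ultimately have far: "((\<lambda>w. 2 / (z - w) ^ 3) has_sum (deriv ^^ 3) (logsum R) z) (far R)"
    using has_sum_cong[of "far R" "\<lambda>w. (deriv ^^ 3) (logfac w) z" "\<lambda>w. 2 / (z - w) ^ 3"] by blast
  have fin: "finite (insert 0 (near R))" by (simp add: finite_near)
  have "0 \<notin> far R" by (simp add: far_def)
  hence disj: "insert 0 (near R) \<inter> far R = {}" using near_far(2)[of R] by blast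
  have "insert 0 (near R) \<union> far R = insert 0 (lat - {0})" by (simp only: Un_insert_left near_far)
  also have "\<dots> = lat" by (rule insert_Diff) simp
  finally have lat: "insert 0 (near R) \<union> far R = lat" .
  have "0 \<notin> near R" by (simp add: near_def)
  hence sum: "(\<Sum>w\<in>insert 0 (near R). 2 / (z - w) ^ 3) = 2 / (z - 0) ^ 3 + (\<Sum>w\<in>near R. 2 / (z - w) ^ 3)"
    by (rule sum.insert[OF finite_near])
  show ?thesis
    using has_sum_Un_disjoint[OF has_sum_finite[OF fin] far disj] unfolding lat sum eq .
qed

text \<open>The second derivative is visibly periodic; each of the two integrations back to \<open>\<zeta>\<close>
  costs a constant, and the first of them vanishes because \<open>\<zeta>'\<close> is even.\<close>
lemma zeta_quasiperiodic:
  assumes v: "v \<in> lat" "v / 2 \<notin> lat" and z: "z \<notin> lat"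
  shows "\<zeta> (z + v) = \<zeta> z + 2 * \<zeta> (v / 2)"
proof -
  have op: "open (- lat)" by (rule open_Compl_lat)
  have Z: "(\<zeta> has_field_derivative deriv \<zeta> x) (at x)" if "x \<notin> lat" for x
    using holomorphic_derivI[OF holomorphic_zeta op] that by auto
  have Z': "(deriv \<zeta> has_field_derivative deriv (deriv \<zeta>) x) (at x)" if "x \<notin> lat" for x
    using holomorphic_derivI[OF holomorphic_deriv[OF holomorphic_zeta op] op] that by auto
  have D: "((\<lambda>x. \<zeta> (x + v) - \<zeta> x) has_field_derivative deriv \<zeta> (x + v) - deriv \<zeta> x) (at x)"
    if "x \<notin> lat" for x
    using Z[of x] Z[of "x + v"] that v by (intro DERIV_diff) (simp_all add: DERIV_shift)
  have D': "((\<lambda>x. deriv \<zeta> (x + v) - deriv \<zeta> x) has_field_derivative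
              deriv (deriv \<zeta>) (x + v) - deriv (deriv \<zeta>) x) (at x)" if "x \<notin> lat" for x
    using Z'[of x] Z'[of "x + v"] that v by (intro DERIV_diff) (simp_all add: DERIV_shift)
  have d2: "deriv (deriv \<zeta>) (x + v) = deriv (deriv \<zeta>) x" if "x \<notin> lat" for x
  proof -
    have "(\<Sum>\<^sub>\<infinity>w\<in>lat. 2 / ((x + v) - w) ^ 3) = (\<Sum>\<^sub>\<infinity>w\<in>lat. 2 / (x - w) ^ 3)"
      by (rule infsum_reindex_bij_witness[of _ "\<lambda>w. w + v" "\<lambda>w. w - v"])
         (use v in \<open>auto simp: lat_diff lat_add algebra_simps\<close>)
    thus ?thesis using has_sum_zeta_deriv2[of x] has_sum_zeta_deriv2[of "x + v"] that v
      by (simp add: infsumI)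
  qed
  have mv: "- (v / 2) \<notin> lat" "- (v / 2) + v = v / 2" using v by (auto simp: field_simps)
  have "(\<lambda>x. deriv \<zeta> (x + v) - deriv \<zeta> x) constant_on - lat"
    by (rule has_field_derivative_0_imp_constant_on[OF _ connected_Compl_lat op])
       (use D' d2 in fastforce)
  then obtain c where c: "\<And>x. x \<notin> lat \<Longrightarrow> deriv \<zeta> (x + v) - deriv \<zeta> x = c" by (auto simp: constant_on_def)
  have even: "deriv \<zeta> (- x) = deriv \<zeta> x" if "x \<notin> lat" for x
  proof -
    have "((\<lambda>x. \<zeta> (- x)) has_field_derivative - deriv \<zeta> (-x)) (at x)"
    proof -
      have "((\<lambda>x. \<zeta> (- x)) has_field_derivative deriv \<zeta> (-x) * (- 1)) (at x)"
        by (rule DERIV_chain2[of \<zeta> _ uminus, OF Z DERIV_minus[OF DERIV_ident]]) (use that in simp)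
      thus ?thesis by simp
    qed
    hence "((\<lambda>x. - \<zeta> x) has_field_derivative - deriv \<zeta> (-x)) (at x)"
      by (simp add: zeta_minus)
    moreover have "((\<lambda>x. - \<zeta> x) has_field_derivative - deriv \<zeta> x) (at x)"
      by (intro DERIV_minus Z that)
    ultimately show ?thesis using DERIV_unique by fastforce
  qed
  \<comment> \<open>At \<open>- v / 2\<close> the difference compares \<open>\<zeta>'\<close> at two opposite points.\<close>
  have "c = 0" using c[OF mv(1)] even[of "v / 2"] v mv by simp
  hence d1: "deriv \<zeta> (x + v) = deriv \<zeta> x" if "x \<notin> lat" for x using c[OF that] by simp
  have "(\<lambda>x. \<zeta> (x + v) - \<zeta> x) constant_on - lat"
    by (rule has_field_derivative_0_imp_constant_on[OF _ connected_Compl_lat op])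
       (use D d1 in fastforce)
  then obtain k where k: "\<And>x. x \<notin> lat \<Longrightarrow> \<zeta> (x + v) - \<zeta> x = k" by (auto simp: constant_on_def)
  from k[OF mv(1)] mv have "k = 2 * \<zeta> (v / 2)" by (simp add: zeta_minus)
  with k[OF z] show ?thesis by (simp add: algebra_simps)
qed

end

section \<open>Legendre's relation\<close>

lemma has_contour_integral_linepath_shift:
  assumes "(f has_contour_integral I) (linepath a b)"
    and "\<And>z. z \<in> closed_segment a b \<Longrightarrow> f (z + v) = f z + c"
  shows "(f has_contour_integral (I + c * (b - a))) (linepath (a + v) (b + v))"
proof -
  have "((\<lambda>z. f z + c) has_contour_integral (I + c * (b - a))) (linepath a b)"
    using assms(1) by (intro has_contour_integral_add has_contour_integral_const_linepath)
  hence "((\<lambda>x. (f (linepath a b x) + c) * (b - a)) has_integral (I + c * (b - a))) {0..1}"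
    by (simp add: has_contour_integral_linepath)
  also have "?this \<longleftrightarrow> ((\<lambda>x. f (linepath (a + v) (b + v) x) * (b - a)) has_integral (I + c * (b - a))) {0..1}"
  proof (rule has_integral_cong)
    fix x :: real assume "x \<in> {0..1}"
    hence "linepath a b x \<in> closed_segment a b" by (simp add: linepath_in_path)
    moreover have "linepath (a + v) (b + v) x = linepath a b x + v"
      by (simp add: linepath_def scaleR_conv_of_real algebra_simps)
    ultimately show "(f (linepath a b x) + c) * (b - a) = f (linepath (a + v) (b + v) x) * (b - a)"
      using assms(2) by simp
  qed
  finally show ?thesis by (simp add: has_contour_integral_linepath)
qed

context lattice_one_tau
begin

abbreviation \<eta>1 where "\<eta>1 \<equiv> weierstrass_eta1 1 \<tau>"
abbreviation \<eta>2 where "\<eta>2 \<equiv> 2 * \<zeta> (\<tau> / 2)"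

lemma half_periods_notin_lat: "1 / 2 \<notin> lat" "\<tau> / 2 \<notin> lat"
proof -
  have h: "(1 / 2 :: real) \<notin> \<int>" by (auto elim!: Ints_cases)
  show "1 / 2 \<notin> lat" "\<tau> / 2 \<notin> lat"
    using of_real_coords_in_lat_iff[of "1 / 2" 0] of_real_coords_in_lat_iff[of 0 "1 / 2"] h by simp_all
qed

lemma zeta_plus_1: "z \<notin> lat \<Longrightarrow> \<zeta> (z + 1) = \<zeta> z + \<eta>1"
  and zeta_plus_tau: "z \<notin> lat \<Longrightarrow> \<zeta> (z + \<tau>) = \<zeta> z + \<eta>2"
  using zeta_quasiperiodic half_periods_notin_lat by (auto simp: weierstrass_eta1_def)

text \<open>The pole at the origin comes from the simple zero of \<open>\<sigma>\<close> there.\<close>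
lemma zeta_residue_limit: "((\<lambda>z. \<zeta> z * z) \<longlongrightarrow> 1) (at 0)"
proof -
  have "\<sigma> \<midarrow>0\<rightarrow> \<sigma> 0" "deriv \<sigma> \<midarrow>0\<rightarrow> deriv \<sigma> 0"
    using holomorphic_on_imp_continuous_on[OF holomorphic_sigma[of UNIV]]
      holomorphic_on_imp_continuous_on[OF holomorphic_deriv[OF holomorphic_sigma[of UNIV]]]
    by (auto simp: continuous_on_eq_continuous_at isCont_def simp del: sigma_0)
  moreover have "((\<lambda>z. \<sigma> z / z) \<longlongrightarrow> 1) (at 0)"
    using has_field_derivative_sigma_0 by (simp add: has_field_derivative_iff)
  ultimately have "((\<lambda>z. deriv \<sigma> z / (\<sigma> z / z)) \<longlongrightarrow> deriv \<sigma> 0 / 1) (at 0)"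
    by (intro tendsto_divide) auto
  thus ?thesis
    using DERIV_imp_deriv[OF has_field_derivative_sigma_0] by (simp add: zeta_eq_logderiv)
qed

text \<open>The rectangle of width \<open>1\<close> and height \<open>Im \<tau>\<close> centred at \<open>0\<close> is a fundamental domain,
  and unlike the period parallelogram it has sides parallel to the axes. Its horizontal sides
  are not translates of each other by a period, only up to the shift by \<open>Re \<tau>\<close>; that shift is
  harmless because \<open>\<zeta>\<close> has a primitive in the strip below the real axis.\<close>
lemma legendre_relation: "\<eta>1 * \<tau> - \<eta>2 = 2 * of_real pi * \<i>"
proof -
  define T where "T = Im \<tau>"
  have T: "T > 0" using Im_tau by (simp add: T_def)
  define a1 a2 a3 a4 where "a1 = Complex (-1/2) (-T/2)" and "a2 = Complex (1/2) (-T/2)"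
    and "a3 = Complex (1/2) (T/2)" and "a4 = Complex (-1/2) (T/2)"
  note a_defs = a1_def a2_def a3_def a4_def
  \<comment> \<open>A slightly larger open box, still without lattice points other than \<open>0\<close>.\<close>
  define S where "S = box (Complex (-3/4) (-3/4*T)) (Complex (3/4) (3/4*T))"
  have in_S: "z \<in> S \<longleftrightarrow> -3/4 < Re z \<and> Re z < 3/4 \<and> -3/4*T < Im z \<and> Im z < 3/4*T" for z
    by (auto simp: S_def in_box_complex_iff)
  have lat_S: "z = 0" if z: "z \<in> lat" "z \<in> S" for z
  proof -
    obtain m n :: int where mn: "z = of_int m + of_int n * \<tau>" using z(1) by (auto simp: lat_iff)
    hence "\<bar>of_int n * T\<bar> < 1 * T" using z(2) T mn by (auto simp: in_S T_def)
    hence "n = 0" using T by (simp add: abs_mult flip: of_int_abs)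
    moreover from this have "\<bar>real_of_int m\<bar> < 1" using z(2) mn by (auto simp: in_S)
    hence "m = 0" by linarith
    ultimately show ?thesis using mn by simp
  qed
  have S: "open S" "connected S" unfolding S_def by (auto intro: convex_connected)
  have img: "path_image (rectpath a1 a3) = cbox a1 a3 - box a1 a3"
    using T by (intro path_image_rectpath_cbox_minus_box) (auto simp: a_defs)
  have sub: "path_image (rectpath a1 a3) \<subseteq> S - {0}"
    unfolding img using T by (auto simp: a_defs in_S in_cbox_complex_iff in_box_complex_iff)
  have lat_img: "path_image (rectpath a1 a3) \<inter> lat = {}" using sub lat_S by blast
  have sides: "closed_segment a1 a2 \<subseteq> path_image (rectpath a1 a3)"
    "closed_segment a2 a3 \<subseteq> path_image (rectpath a1 a3)"
    "closed_segment a3 a4 \<subseteq> path_image (rectpath a1 a3)"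
    "closed_segment a4 a1 \<subseteq> path_image (rectpath a1 a3)"
    by (auto simp: rectpath_def Let_def path_image_join a_defs)
  have holo: "\<zeta> holomorphic_on S - {0}"
    by (rule holomorphic_on_subset[OF holomorphic_zeta]) (use lat_S in auto)
  have "contour_integral (rectpath a1 a3) \<zeta> =
          2 * pi * \<i> * (\<Sum>p\<in>{0}. winding_number (rectpath a1 a3) p * residue \<zeta> p)"
  proof (rule Residue_theorem[OF S _ holo _ _ sub])
    show "\<forall>z. z \<notin> S \<longrightarrow> winding_number (rectpath a1 a3) z = 0"
      using T by (intro allI impI winding_number_rectpath_outside)
        (auto simp: a_defs in_S in_cbox_complex_iff)
  qed auto
  moreover have "winding_number (rectpath a1 a3) 0 = 1"
    by (rule winding_number_rectpath) (use T in \<open>auto simp: a_defs in_box_complex_iff\<close>)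
  moreover have "residue \<zeta> 0 = 1"
    by (rule residue_simple'[OF S(1) _ holo]) (use T zeta_residue_limit in \<open>auto simp: in_S\<close>)
  ultimately have residue: "contour_integral (rectpath a1 a3) \<zeta> = 2 * of_real pi * \<i>" by simp

  have pts: "a1 + 1 = a2" "a4 + 1 = a3" "a4 - a1 = \<i> * T"
    by (auto simp: a_defs complex_eq_iff)
  have int: "\<zeta> contour_integrable_on (linepath a b)"
    if "closed_segment a b \<subseteq> path_image (rectpath a1 a3)" for a b
    by (rule contour_integrable_continuous_linepath,
        rule holomorphic_on_imp_continuous_on, rule holomorphic_on_subset[OF holomorphic_zeta])
       (use that lat_img in blast)
  have "contour_integral (rectpath a1 a3) \<zeta> =
    contour_integral (linepath a1 a2) \<zeta> + (contour_integral (linepath a2 a3) \<zeta> +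
    (contour_integral (linepath a3 a4) \<zeta> + contour_integral (linepath a4 a1) \<zeta>))"
    using int[OF sides(1)] int[OF sides(2)] int[OF sides(3)] int[OF sides(4)]
    by (simp add: rectpath_def Let_def flip: a2_def a4_def)
       (simp add: a_defs contour_integrable_join)
  moreover have "continuous_on (closed_segment a b) \<zeta>"
    if "closed_segment a b \<subseteq> path_image (rectpath a1 a3)" for a b
    by (rule holomorphic_on_imp_continuous_on, rule holomorphic_on_subset[OF holomorphic_zeta])
       (use that lat_img in blast)
  ultimately have sum: "contour_integral (linepath a1 a2) \<zeta> + contour_integral (linepath a2 a3) \<zeta> -
    contour_integral (linepath a4 a3) \<zeta> - contour_integral (linepath a1 a4) \<zeta> = 2 * of_real pi * \<i>"
    using residue contour_integral_reverse_linepath[of a3 a4 \<zeta>]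
      contour_integral_reverse_linepath[of a4 a1 \<zeta>] sides by (simp add: algebra_simps)

  have vert: "contour_integral (linepath a2 a3) \<zeta> = contour_integral (linepath a1 a4) \<zeta> + \<eta>1 * (\<i> * T)"
  proof (rule contour_integral_unique)
    have "(\<zeta> has_contour_integral (contour_integral (linepath a1 a4) \<zeta> + \<eta>1 * (a4 - a1)))
            (linepath (a1 + 1) (a4 + 1))"
      by (rule has_contour_integral_linepath_shift)
         (use int sides lat_img in \<open>auto simp: closed_segment_commute intro!: has_contour_integral_integral zeta_plus_1\<close>)
    thus "(\<zeta> has_contour_integral (contour_integral (linepath a1 a4) \<zeta> + \<eta>1 * (\<i> * T))) (linepath a2 a3)"
      by (simp only: pts)
  qed

  define V where "V = {z. Im z < 0} \<inter> {z. Im z > - T}"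
  have V: "convex V" "open V"
    unfolding V_def by (auto intro!: convex_Int convex_halfspace_Im_lt convex_halfspace_Im_gt
       open_Int open_halfspace_Im_lt open_halfspace_Im_gt)
  have V_lat: "z \<notin> lat" if "z \<in> V" for z
  proof
    assume "z \<in> lat"
    then obtain m n :: int where "z = of_int m + of_int n * \<tau>" by (auto simp: lat_iff)
    hence n: "Im z = of_int n * T" by (simp add: T_def)
    with that have "of_int n * T < 0 * T" "-1 * T < of_int n * T" by (auto simp: V_def)
    with T have "real_of_int n < 0" "-1 < real_of_int n" by (simp_all only: mult_less_cancel_right_pos)
    moreover from this(1) have "n \<le> -1" by simp
    hence "real_of_int n \<le> -1" by linarith
    ultimately show False by linarith
  qed
  obtain L where L: "\<And>z. z \<in> V \<Longrightarrow> (L has_field_derivative \<zeta> z) (at z within V)"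
    by (rule holomorphic_convex_primitive'[OF V, of \<zeta>])
       (use V_lat in \<open>auto intro: holomorphic_on_subset[OF holomorphic_zeta]\<close>)
  have L': "(L has_field_derivative \<zeta> z) (at z)" if "z \<in> V" for z
    using L[OF that] at_within_open[OF that V(2)] by simp
  have V_shift: "z + of_real x \<in> V \<longleftrightarrow> z \<in> V" for z x by (simp add: V_def)
  have "(\<lambda>z. L (z + 1) - L z - \<eta>1 * z) constant_on V"
  proof (rule has_field_derivative_0_imp_constant_on[OF _ convex_connected[OF V(1)] V(2)])
    fix z assume z: "z \<in> V"
    have "((\<lambda>z. L (z + 1)) has_field_derivative \<zeta> (z + 1)) (at z)"
      using L'[of "z + 1"] V_shift[of z 1] z by (simp add: DERIV_shift)
    hence "((\<lambda>z. L (z + 1) - L z - \<eta>1 * z) has_field_derivative \<zeta> (z + 1) - \<zeta> z - \<eta>1) (at z)"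
      using L'[OF z] by (auto intro!: derivative_eq_intros)
    thus "((\<lambda>z. L (z + 1) - L z - \<eta>1 * z) has_field_derivative 0) (at z)"
      using zeta_plus_1[OF V_lat[OF z]] by simp
  qed
  then obtain k where k: "\<And>z. z \<in> V \<Longrightarrow> L (z + 1) - L z = \<eta>1 * z + k"
    by (auto simp: constant_on_def algebra_simps) 
  have horiz: "(\<zeta> has_contour_integral (\<eta>1 * z + k)) (linepath z (z + 1))" if "z \<in> V" for z
  proof -
    have sub: "path_image (linepath z (z + 1)) \<subseteq> V"
      using V_shift[of z 1] that V(1) by (simp add: closed_segment_subset)
    show ?thesis
      using contour_integral_primitive[OF L valid_path_linepath sub] k[OF that] by simp
  qed
  have a1V: "a1 \<in> V" "a1 - Re \<tau> \<in> V" using T by (auto simp: V_def a_defs)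
  have bottom: "contour_integral (linepath a1 a2) \<zeta> = \<eta>1 * a1 + k"
  proof (rule contour_integral_unique)
    show "(\<zeta> has_contour_integral \<eta>1 * a1 + k) (linepath a1 a2)"
      using horiz[OF a1V(1)] by (simp only: pts)
  qed
  have top: "contour_integral (linepath a4 a3) \<zeta> = \<eta>1 * (a1 - Re \<tau>) + k + \<eta>2"
  proof (rule contour_integral_unique)
    have "closed_segment (a1 - Re \<tau>) (a1 - Re \<tau> + 1) \<subseteq> V"
      using V_shift[of "a1 - Re \<tau>" 1] a1V(2) V(1) by (simp add: closed_segment_subset)
    hence "(\<zeta> has_contour_integral (\<eta>1 * (a1 - Re \<tau>) + k + \<eta>2 * ((a1 - Re \<tau> + 1) - (a1 - Re \<tau>))))
            (linepath (a1 - Re \<tau> + \<tau>) (a1 - Re \<tau> + 1 + \<tau>))"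
      by (intro has_contour_integral_linepath_shift horiz a1V zeta_plus_tau V_lat) auto
    moreover have "a1 - Re \<tau> + \<tau> = a4" "a1 - Re \<tau> + 1 + \<tau> = a3"
      by (auto simp: a_defs complex_eq_iff T_def)
    ultimately show "(\<zeta> has_contour_integral (\<eta>1 * (a1 - Re \<tau>) + k + \<eta>2)) (linepath a4 a3)"
      by simp
  qed
  have "\<eta>1 * (of_real (Re \<tau>) + \<i> * T) - \<eta>2 = 2 * of_real pi * \<i>"
    using sum unfolding vert bottom top by (simp add: algebra_simps)
  also have "of_real (Re \<tau>) + \<i> * T = \<tau>" by (simp add: complex_eq_iff T_def)
  finally show ?thesis .
qed

end

section \<open>Principal parts and entire quasi-periodic functions\<close>

text \<open>Dividing \<open>v\<close> by \<open>z - p\<close> leaves a function \<open>w\<close> that does not vanish at \<open>p\<close>. After subtraction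
  of the principal part, \<open>u / v\<close> is the difference quotient of \<open>u / w\<close> at \<open>p\<close>, which converges to a
  derivative.\<close>
lemma simple_zero_quotient_principal_part:
  assumes u: "u analytic_on {p}" and v: "v analytic_on {p}" "v p = 0" "deriv v p \<noteq> 0"
  shows "\<exists>l. (\<lambda>z. u z / v z - (u p / deriv v p) / (z - p)) \<midarrow>p\<rightarrow> l"
proof -
  obtain S where S: "open S" "p \<in> S" "u holomorphic_on S" "v holomorphic_on S"
    using u v(1) analytic_at_two[of u p v] by blast
  define w where "w = (\<lambda>z. if z = p then deriv v p else (v z - v p) / (z - p))"
  have w: "w holomorphic_on S" unfolding w_def by (rule pole_lemma_open[OF S(4,1)])
  have "isCont w p"
    using holomorphic_on_imp_continuous_on[OF w] S(1,2) by (simp add: continuous_on_eq_continuous_at)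
  moreover have wp: "w p = deriv v p" by (simp add: w_def)
  ultimately have nz: "\<forall>\<^sub>F z in at p. w z \<noteq> 0"
    using v(3) by (auto simp: isCont_def intro: tendsto_imp_eventually_ne)
  have "w analytic_on {p}" "u analytic_on {p}" using w S by (auto simp: analytic_at)
  hence "(\<lambda>z. u z / w z) analytic_on {p}" using v(3) wp by (intro analytic_intros) auto
  then obtain d where "((\<lambda>z. u z / w z) has_field_derivative d) (at p)"
    by (meson analytic_derivI)
  hence "((\<lambda>z. (u z / w z - u p / w p) / (z - p)) \<longlongrightarrow> d) (at p)"
    by (simp add: has_field_derivative_iff)
  moreover have "\<forall>\<^sub>F z in at p. (u z / w z - u p / w p) / (z - p) = u z / v z - (u p / deriv v p) / (z - p)"
    using nz eventually_neq_at_within[of p p UNIV]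
  proof eventually_elim
    case (elim z)
    hence "v z = (z - p) * w z" "v z \<noteq> 0" using v(2) by (auto simp: w_def)
    thus ?case using elim wp by (simp add: diff_divide_distrib mult.commute)
  qed
  ultimately show ?thesis by (blast intro: Lim_transform_eventually)
qed

context lattice_one_tau
begin

text \<open>Stated for an arbitrary type of values so that it applies both to periodic functions and to
  periodic properties of points.\<close>
lemma lat_invariant:
  assumes "\<And>z. P (z + 1) = P z" "\<And>z. P (z + \<tau>) = P z" "w \<in> lat"
  shows "P (z + w) = P z"
proof -
  have int: "P (z + of_int m * v) = P z" if "\<And>z. P (z + v) = P z" for z v :: complex and m :: int
  proof (induction m rule: int_induct[where k = 0])
    case (step1 i)
    thus ?case using that[of "z + of_int i * v"] by (simp add: algebra_simps)
  next
    case (step2 i)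
    thus ?case using that[of "z + of_int (i - 1) * v"] by (simp add: algebra_simps)
  qed auto
  obtain m n :: int where "w = of_int m + of_int n * \<tau>" using assms(3) by (auto simp: lat_iff)
  thus ?thesis
    using int[of 1 "z + of_int n * \<tau>" m] int[of \<tau> z n] assms(1,2) by (simp add: add_ac)
qed

lemma entire_periodic_constant:
  assumes g: "g holomorphic_on UNIV" and "\<And>z. g (z + 1) = g z" "\<And>z. g (z + \<tau>) = g z"
  shows "g constant_on UNIV"
proof (rule Liouville_theorem[OF g])
  define K where "K = (\<lambda>(x, y). of_real x + of_real y * \<tau>) ` ({0..1} \<times> {0..1})"
  have "compact K" unfolding K_def
    by (intro compact_continuous_image compact_Times) (auto intro!: continuous_intros simp: case_prod_unfold)
  hence "bounded (g ` K)"
    by (intro compact_imp_bounded compact_continuous_image continuous_on_subset[OF holomorphic_on_imp_continuous_on[OF g]]) auto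
  moreover have "range g \<subseteq> g ` K"
  proof clarify
    fix z
    define x y where "x = Re z - Im z / Im \<tau> * Re \<tau>" and "y = Im z / Im \<tau>"
    define w where "w = of_int \<lfloor>x\<rfloor> + of_int \<lfloor>y\<rfloor> * \<tau>"
    have "z = of_real x + of_real y * \<tau>"
      using Im_tau by (auto simp: complex_eq_iff x_def y_def)
    hence "z = (of_real (frac x) + of_real (frac y) * \<tau>) + w"
      by (simp add: w_def frac_def algebra_simps)
    moreover have "g ((of_real (frac x) + of_real (frac y) * \<tau>) + w) = g (of_real (frac x) + of_real (frac y) * \<tau>)"
      by (rule lat_invariant) (use assms in \<open>auto simp: lat_iff w_def\<close>)
    moreover have "of_real (frac x) + of_real (frac y) * \<tau> \<in> K"
      unfolding K_def by (intro image_eqI[of _ _ "(frac x, frac y)"]) (auto intro: less_imp_le frac_lt_1)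
    ultimately show "g z \<in> g ` K" by auto
  qed
  ultimately show "bounded (range g)" by (rule bounded_subset)
qed

lemma entire_quasiperiodic_affine:
  assumes g: "g holomorphic_on UNIV" and p: "\<And>z. g (z + 1) = g z + p" and q: "\<And>z. g (z + \<tau>) = g z + q"
  shows "g z = g 0 + p * z" "q = p * \<tau>"
proof -
  have D: "(g has_field_derivative deriv g z) (at z)" for z
    using holomorphic_derivI[OF g] by auto
  have per: "deriv g (z + v) = deriv g z" if "\<And>z. g (z + v) = g z + k" for z v k
  proof -
    have "((\<lambda>z. g (z + v)) has_field_derivative deriv g (z + v)) (at z)"
      using D[of "z + v"] by (simp add: DERIV_shift)
    moreover have "((\<lambda>z. g (z + v)) has_field_derivative deriv g z) (at z)"
      unfolding that using D by (auto intro!: derivative_eq_intros)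
    ultimately show ?thesis by (rule DERIV_unique)
  qed
  have "deriv g constant_on UNIV"
    by (rule entire_periodic_constant) (use g per[OF p] per[OF q] in \<open>auto intro: holomorphic_deriv\<close>)
  then obtain \<alpha> where \<alpha>: "\<And>z. deriv g z = \<alpha>" by (auto simp: constant_on_def)
  have "(\<lambda>z. g z - \<alpha> * z) constant_on UNIV"
    by (rule has_field_derivative_0_imp_constant_on)
       (use D in \<open>auto intro!: derivative_eq_intros simp: \<alpha>\<close>)
  then obtain \<beta> where "\<And>z. g z - \<alpha> * z = \<beta>" by (auto simp: constant_on_def)
  hence \<beta>: "g z = \<beta> + \<alpha> * z" for z by (metis diff_add_cancel)
  have "\<alpha> = p" using p[of 0] by (simp add: \<beta>)
  thus "g z = g 0 + p * z" "q = p * \<tau>" using q[of 0] by (auto simp: \<beta>)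
qed

lemma eventually_notin_lat: "\<forall>\<^sub>F z in at p. z - a \<notin> lat"
proof -
  have "\<forall>\<^sub>F z in at (p - a). z \<notin> lat"
    using not_islimpt_lat[of "p - a"] by (simp add: islimpt_iff_eventually)
  moreover have "filterlim (\<lambda>z. z - a) (at (p - a)) (at p)"
    by (auto simp: filterlim_at intro!: tendsto_intros eventually_neq_at_within elim!: eventually_mono)
  ultimately show ?thesis by (rule eventually_compose_filterlim)
qed

lemma zeta_principal_part: "\<exists>l. (\<lambda>z. \<zeta> (z - a) - 1 / (z - a)) \<midarrow>a\<rightarrow> l"
proof -
  have s: "\<sigma> analytic_on {0}" using holomorphic_sigma[of UNIV] by (auto simp: analytic_at)
  have d: "deriv \<sigma> 0 = 1" by (rule DERIV_imp_deriv[OF has_field_derivative_sigma_0])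
  have "deriv \<sigma> analytic_on {0}" using s by (rule analytic_deriv)
  from simple_zero_quotient_principal_part[OF this s]
  obtain l where "(\<lambda>z. \<zeta> z - 1 / z) \<midarrow>0\<rightarrow> l" by (auto simp: d zeta_eq_logderiv)
  from LIM_offset[OF this, of "- a"] show ?thesis by auto
qed

lemma analytic_sigma_shift: "(\<lambda>z. \<sigma> (z - a)) analytic_on A"
proof -
  have "(\<sigma> \<circ> (\<lambda>z. z - a)) holomorphic_on UNIV"
    by (rule holomorphic_on_compose[OF _ holomorphic_sigma]) (intro holomorphic_intros)
  hence "(\<lambda>z. \<sigma> (z - a)) analytic_on UNIV" by (simp add: analytic_on_open o_def)
  thus ?thesis by (rule analytic_on_subset) simp
qed

lemma analytic_zeta: "z \<notin> lat \<Longrightarrow> \<zeta> analytic_on {z}"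
  using holomorphic_zeta open_Compl_lat by (auto simp: analytic_at)

lemma analytic_zeta_shift:
  assumes "z - a \<notin> lat"
  shows "(\<lambda>z. \<zeta> (z - a)) analytic_on {z}"
proof -
  have "(\<zeta> \<circ> (\<lambda>z. z - a)) analytic_on {z}"
    by (rule analytic_on_compose) (use assms analytic_zeta in \<open>auto intro!: analytic_intros\<close>)
  thus ?thesis by (simp add: o_def)
qed

end

section \<open>Quotients with simple poles at the zeros of a sigma product\<close>

context lattice_one_tau
begin

lemma isCont_sigma: "isCont \<sigma> z"
  using holomorphic_on_imp_continuous_on[OF holomorphic_sigma[of UNIV]]
  by (simp add: continuous_on_eq_continuous_at)

text \<open>The quasi-periods carry the existence of a limit from one point to its whole class modulo the
  lattice, so it suffices to inspect one point of each class. They also survive the extension by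
  continuity, since the domain \<open>\<Omega>\<close> is dense.\<close>
lemma remove_sings_entire_periods:
  fixes q :: "complex \<Rightarrow> complex"
  assumes \<Omega>: "open \<Omega>" "\<And>p. \<forall>\<^sub>F z in at p. z \<in> \<Omega>" and q: "q holomorphic_on \<Omega>"
    and per: "\<And>z. z + 1 \<in> \<Omega> \<longleftrightarrow> z \<in> \<Omega>" "\<And>z. z + \<tau> \<in> \<Omega> \<longleftrightarrow> z \<in> \<Omega>"
      "\<forall>z\<in>\<Omega>. q (z + 1) = q z + b1" "\<forall>z\<in>\<Omega>. q (z + \<tau>) = q z + b2"
    and sing: "\<forall>p\<in>-\<Omega>. \<exists>w\<in>lat. \<exists>l. q \<midarrow>p + w\<rightarrow> l"
  shows "remove_sings q holomorphic_on UNIV"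
    "\<And>z. remove_sings q (z + 1) = remove_sings q z + b1"
    "\<And>z. remove_sings q (z + \<tau>) = remove_sings q z + b2"
    "\<And>z. z \<in> \<Omega> \<Longrightarrow> remove_sings q z = q z"
    "\<And>p l. q \<midarrow>p\<rightarrow> l \<Longrightarrow> remove_sings q p = l"
proof -
  define g where "g = remove_sings q"
  have ana: "q analytic_on {z}" if "z \<in> \<Omega>" for z using q \<Omega>(1) that by (auto simp: analytic_at)
  have g_eq: "g z = q z" if "z \<in> \<Omega>" for z
    unfolding g_def using ana[OF that] by (rule remove_sings_at_analytic)
  have iso: "isolated_singularity_at q p" for p
  proof -
    obtain r where r: "r > 0" "\<And>z. z \<noteq> p \<Longrightarrow> dist z p < r \<Longrightarrow> z \<in> \<Omega>"
      using \<Omega>(2)[of p] by (auto simp: eventually_at)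
    have "q holomorphic_on (ball p r - {p})"
    proof (rule holomorphic_on_subset[OF q], rule subsetI)
      fix x assume "x \<in> ball p r - {p}"
      thus "x \<in> \<Omega>" using r(2)[of x] by (simp add: dist_commute)
    qed
    moreover have "open (ball p r - {p})" by auto
    ultimately show ?thesis
      using r(1) unfolding isolated_singularity_at_def by (subst (asm) analytic_on_open[symmetric]) auto
  qed
  have half: "\<exists>l. q \<midarrow>p\<rightarrow> l"
    if v: "\<And>z. z + v \<in> \<Omega> \<longleftrightarrow> z \<in> \<Omega>" "\<And>z. z \<in> \<Omega> \<Longrightarrow> q (z + v) = q z + b"
      and l: "q \<midarrow>p + v\<rightarrow> l" for p v b l
  proof -
    have "(\<lambda>z. q (z + v) - b) \<midarrow>p\<rightarrow> l - b"
      using LIM_offset[OF l, of v] by (auto intro!: tendsto_intros)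
    moreover have "\<forall>\<^sub>F z in at p. q (z + v) - b = q z"
      using \<Omega>(2)[of p] by eventually_elim (auto simp: v)
    ultimately show ?thesis by (blast intro: Lim_transform_eventually)
  qed
  have lim_iff: "(\<exists>l. q \<midarrow>p + v\<rightarrow> l) \<longleftrightarrow> (\<exists>l. q \<midarrow>p\<rightarrow> l)"
    if v: "\<And>z. z + v \<in> \<Omega> \<longleftrightarrow> z \<in> \<Omega>" "\<And>z. z \<in> \<Omega> \<Longrightarrow> q (z + v) = q z + b" for p v b
  proof -
    have "q (z + - v) = q z + (- b)" if "z \<in> \<Omega>" for z
      using v(1)[of "z - v"] v(2)[of "z - v"] that by simp
    moreover have "z + - v \<in> \<Omega> \<longleftrightarrow> z \<in> \<Omega>" for z using v(1)[of "z - v"] by simp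
    ultimately have "\<exists>l. q \<midarrow>p + v\<rightarrow> l" if "q \<midarrow>p\<rightarrow> l" for l
      using half[where v = "- v" and b = "- b" and p = "p + v" and l = l] that by simp
    thus ?thesis using half[OF v] by blast
  qed
  have lims: "\<exists>l. q \<midarrow>p\<rightarrow> l" for p
  proof (cases "p \<in> \<Omega>")
    case True
    thus ?thesis using analytic_at_imp_isCont[OF ana] by (auto simp: isCont_def)
  next
    case False
    then obtain w where w: "w \<in> lat" "\<exists>l. q \<midarrow>p + w\<rightarrow> l" using sing by blast
    thus ?thesis
      using lat_invariant[of "\<lambda>p. \<exists>l. q \<midarrow>p\<rightarrow> l" w p] lim_iff[OF per(1) bspec[OF per(3)]] lim_iff[OF per(2) bspec[OF per(4)]]
      by simp
  qed
  have "g analytic_on UNIV"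
    unfolding g_def using remove_sings_analytic_at[OF iso] lims
    by (subst analytic_on_analytic_at) blast
  thus holo: "remove_sings q holomorphic_on UNIV" by (auto simp: g_def intro: analytic_imp_holomorphic)
  have cont: "g \<midarrow>p\<rightarrow> g p" for p
    using holomorphic_on_imp_continuous_on[OF holo]
    by (simp add: g_def continuous_on_eq_continuous_at isCont_def)
  have shift: "g (p + v) = g p + b"
    if v: "\<And>z. z + v \<in> \<Omega> \<longleftrightarrow> z \<in> \<Omega>" "\<And>z. z \<in> \<Omega> \<Longrightarrow> q (z + v) = q z + b" for p v b
  proof (rule tendsto_unique)
    have "(\<lambda>z. g (z + v)) \<midarrow>p\<rightarrow> g (p + v)" using LIM_offset[OF cont, of v "p + v"] by simp
    moreover have "\<forall>\<^sub>F z in at p. g (z + v) = g z + b"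
      using \<Omega>(2)[of p] by eventually_elim (auto simp: v g_eq)
    ultimately show "(\<lambda>z. g z + b) \<midarrow>p\<rightarrow> g (p + v)" by (rule Lim_transform_eventually)
    show "(\<lambda>z. g z + b) \<midarrow>p\<rightarrow> g p + b" by (intro tendsto_intros cont)
  qed auto
  show "remove_sings q (z + 1) = remove_sings q z + b1" for z
    using shift[OF per(1) bspec[OF per(3)]] by (simp add: g_def)
  show "remove_sings q (z + \<tau>) = remove_sings q z + b2" for z
    using shift[OF per(2) bspec[OF per(4)]] by (simp add: g_def)
  show "z \<in> \<Omega> \<Longrightarrow> remove_sings q z = q z" for z using g_eq by (simp add: g_def)
  show "q \<midarrow>p\<rightarrow> l \<Longrightarrow> remove_sings q p = l" for p l by (rule remove_sings_eqI)
qed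

text \<open>The argument at a fixed value of the parameter. Here \<open>F\<close> stands for the spatial derivative of an
  elliptic function, \<open>G\<close> for its parameter derivative and \<open>\<omega>'\<close> for the velocity of the period \<open>\<tau>\<close>;
  \<open>G_periods\<close> is what differentiation of the periodicity equations yields. The constants \<open>b1\<close> and
  \<open>b2\<close> in the proof are the additive quasi-periods of \<open>G / F\<close> minus the sum of zeta functions.\<close>
theorem quotient_eq_zeta_sum:
  fixes F G :: "complex \<Rightarrow> complex" and a D \<gamma> :: "nat \<Rightarrow> complex" and c \<omega>' :: complex and n :: nat
  assumes F: "\<And>z. z \<notin> lat \<Longrightarrow> F z = c * (\<Prod>k=0..n. \<sigma> (z - a k)) / \<sigma> z ^ (n + 1)"
    and c: "c \<noteq> 0"
    and a: "\<And>k. k \<le> n \<Longrightarrow> a k \<notin> lat" "\<And>j k. j \<le> n \<Longrightarrow> k \<le> n \<Longrightarrow> j \<noteq> k \<Longrightarrow> a k - a j \<notin> lat"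
    and F_periodic: "\<And>z. z \<notin> lat \<Longrightarrow> F (z + 1) = F z" "\<And>z. z \<notin> lat \<Longrightarrow> F (z + \<tau>) = F z"
    and G: "G holomorphic_on - lat"
    and G_periods: "\<And>z. z \<notin> lat \<Longrightarrow> G (z + 1) = G z" "\<And>z. z \<notin> lat \<Longrightarrow> G (z + \<tau>) + \<omega>' * F z = G z"
    and G_bounded: "\<forall>\<^sub>F z in at 0. norm (z ^ n * G z) \<le> B"
    and G0: "G (a 0) = 0"
    and D: "\<And>k. D k = c * (\<Prod>j\<in>{0..n} - {k}. \<sigma> (a k - a j)) / \<sigma> (a k) ^ (n + 1)"
    and \<gamma>: "\<And>k. \<lbrakk>1 \<le> k; k \<le> n\<rbrakk> \<Longrightarrow> \<gamma> k = G (a k) / D k"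
  shows "\<And>z. z \<notin> lat \<Longrightarrow> F z \<noteq> 0 \<Longrightarrow>
           G z / F z = (\<Sum>j=1..n. \<gamma> j * (\<zeta> (z - a j) + \<zeta> (a j) - \<eta>1 * z))"
    and "\<omega>' = 2 * of_real pi * \<i> * (\<Sum>j=1..n. \<gamma> j)"
proof -
  have F_eq_0: "F z = 0 \<longleftrightarrow> (\<exists>k\<le>n. z - a k \<in> lat)" if "z \<notin> lat" for z
    using F[OF that] c that by (auto simp: sigma_eq_0_iff)
  have F_holo: "F holomorphic_on - lat"
  proof (subst holomorphic_cong[OF refl F])
    show "(\<lambda>z. c * (\<Prod>k=0..n. \<sigma> (z - a k)) / \<sigma> z ^ (n + 1)) holomorphic_on - lat"
      by (intro holomorphic_on_divide holomorphic_on_mult holomorphic_on_prod holomorphic_on_power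
          holomorphic_on_const holomorphic_sigma analytic_imp_holomorphic[OF analytic_sigma_shift])
         (auto simp: sigma_eq_0_iff)
  qed auto
  have F_ana: "F analytic_on {z}" "G analytic_on {z}" if "z \<notin> lat" for z
    using F_holo G open_Compl_lat that by (auto simp: analytic_at)
  define S where "S = (\<lambda>z. \<Sum>j=1..n. \<gamma> j * \<zeta> (z - a j))"
  define q where "q = (\<lambda>z. G z / F z - S z)"
  define \<Omega> where "\<Omega> = (\<Inter>k\<in>{0..n}. {z. z - a k \<notin> lat}) \<inter> - lat"
  have in_\<Omega>: "z \<in> \<Omega> \<longleftrightarrow> z \<notin> lat \<and> (\<forall>k\<le>n. z - a k \<notin> lat)" for z by (auto simp: \<Omega>_def)
  have \<Omega>1: "open \<Omega>"
  proof -
    have "open {z. z - a k \<notin> lat}" for k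
    proof -
      have "continuous_on UNIV (\<lambda>z. z - a k)" by (intro continuous_intros)
      from open_vimage[OF open_Compl_lat this] show ?thesis by (simp add: vimage_def)
    qed
    thus ?thesis unfolding \<Omega>_def using open_Compl_lat by auto
  qed
  have \<Omega>2: "\<forall>\<^sub>F z in at p. z \<in> \<Omega>" for p
  proof -
    have "\<forall>\<^sub>F z in at p. \<forall>k\<in>{..n}. z - a k \<notin> lat"
      by (intro eventually_ball_finite ballI eventually_notin_lat) auto
    with eventually_notin_lat[of 0 p] show ?thesis by eventually_elim (auto simp: in_\<Omega>)
  qed
  have \<Omega>_shift: "z + w \<in> \<Omega> \<longleftrightarrow> z \<in> \<Omega>" if "w \<in> lat" for z w
  proof -
    have "z + w - a k \<in> lat \<longleftrightarrow> z - a k \<in> lat" for k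
      using lat_add_cancel[OF that, of "z - a k"] by (simp add: algebra_simps)
    thus ?thesis using lat_add_cancel[OF that, of z] by (simp add: in_\<Omega>)
  qed
  have S_ana: "S analytic_on {z}" if "\<And>k. 1 \<le> k \<Longrightarrow> k \<le> n \<Longrightarrow> z - a k \<notin> lat" for z
    unfolding S_def
    by (intro analytic_on_sum analytic_on_mult analytic_on_const analytic_zeta_shift) (use that in auto)
  have q_holo: "q holomorphic_on \<Omega>"
    unfolding q_def
  proof (rule analytic_imp_holomorphic, subst analytic_on_analytic_at, rule ballI, intro analytic_intros)
    fix z assume "z \<in> \<Omega>"
    thus "G analytic_on {z}" "F analytic_on {z}" "S analytic_on {z}" "\<And>w. w \<in> {z} \<Longrightarrow> F w \<noteq> 0"
      using F_ana[of z] S_ana[of z] F_eq_0[of z] by (auto simp: in_\<Omega>)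
  qed
  have S1: "S (z + 1) = S z + (\<Sum>j=1..n. \<gamma> j) * \<eta>1" and S2: "S (z + \<tau>) = S z + (\<Sum>j=1..n. \<gamma> j) * \<eta>2"
    if "z \<in> \<Omega>" for z
  proof -
    have "\<zeta> (z + 1 - a j) = \<zeta> (z - a j) + \<eta>1" "\<zeta> (z + \<tau> - a j) = \<zeta> (z - a j) + \<eta>2" if "j \<in> {1..n}" for j
      using zeta_plus_1[of "z - a j"] zeta_plus_tau[of "z - a j"] \<open>z \<in> \<Omega>\<close> that
      by (auto simp: in_\<Omega> algebra_simps)
    thus "S (z + 1) = S z + (\<Sum>j=1..n. \<gamma> j) * \<eta>1" "S (z + \<tau>) = S z + (\<Sum>j=1..n. \<gamma> j) * \<eta>2"
      by (simp_all add: S_def distrib_left sum.distrib sum_distrib_right)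
  qed
  define b1 b2 where "b1 = - (\<Sum>j=1..n. \<gamma> j) * \<eta>1" and "b2 = - \<omega>' - (\<Sum>j=1..n. \<gamma> j) * \<eta>2"
  have q1: "q (z + 1) = q z + b1" and q2: "q (z + \<tau>) = q z + b2" if z: "z \<in> \<Omega>" for z
  proof -
    have "z \<notin> lat" "F z \<noteq> 0" using z F_eq_0[of z] by (auto simp: in_\<Omega>)
    moreover have "G (z + \<tau>) = G z - \<omega>' * F z" using G_periods(2)[of z] \<open>z \<notin> lat\<close> by (simp add: eq_diff_eq)
    ultimately show "q (z + 1) = q z + b1" "q (z + \<tau>) = q z + b2"
      using F_periodic[of z] G_periods(1)[of z] S1[OF z] S2[OF z]
      by (auto simp: q_def b1_def b2_def field_simps)
  qed

  \<comment> \<open>At the origin the pole of \<open>F\<close> has order \<open>n + 1\<close>, while that of \<open>G\<close> has order at most \<open>n\<close>.\<close>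
  have lim0: "(\<lambda>z. G z / F z) \<midarrow>0\<rightarrow> 0"
  proof -
    have sz: "(\<lambda>z. z / \<sigma> z) \<midarrow>0\<rightarrow> 1"
    proof -
      have "(\<lambda>z. \<sigma> z / z) \<midarrow>0\<rightarrow> 1"
        using has_field_derivative_sigma_0 by (simp add: has_field_derivative_iff)
      from tendsto_inverse[OF this] show ?thesis by simp
    qed
    define L where "L = c * (\<Prod>k=0..n. \<sigma> (0 - a k)) * 1 ^ (n + 1)"
    have "L \<noteq> 0" using c a(1) by (auto simp: L_def sigma_eq_0_iff)
    have "(\<lambda>z. c * (\<Prod>k=0..n. \<sigma> (z - a k)) * (z / \<sigma> z) ^ (n + 1)) \<midarrow>0\<rightarrow> L"
      unfolding L_def
      by (intro tendsto_intros sz isCont_tendsto_compose[OF isCont_sigma])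
    moreover have "\<forall>\<^sub>F z in at 0. c * (\<Prod>k=0..n. \<sigma> (z - a k)) * (z / \<sigma> z) ^ (n + 1) = z ^ (n + 1) * F z"
      using eventually_notin_lat[of 0 0] by eventually_elim (simp add: F power_divide)
    ultimately have F0: "(\<lambda>z. z ^ (n + 1) * F z) \<midarrow>0\<rightarrow> L" by (rule Lim_transform_eventually)
    have "(\<lambda>z::complex. norm (z * of_real B / (z ^ (n + 1) * F z))) \<midarrow>0\<rightarrow> norm (0 * of_real B / L)"
      by (intro tendsto_intros F0 \<open>L \<noteq> 0\<close>)
    hence "(\<lambda>z::complex. norm (z * of_real B / (z ^ (n + 1) * F z))) \<midarrow>0\<rightarrow> 0" by simp
    moreover have "\<forall>\<^sub>F z in at 0. norm (G z / F z) \<le> norm (z * of_real B / (z ^ (n + 1) * F z))"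
      using G_bounded eventually_neq_at_within[of 0 0 UNIV]
    proof eventually_elim
      case (elim z)
      have "norm (G z / F z) = norm (z * (z ^ n * G z) / (z ^ (n + 1) * F z))"
        using elim by (simp add: field_simps)
      also have "\<dots> = norm z * norm (z ^ n * G z) / norm (z ^ (n + 1) * F z)"
        by (simp only: norm_mult norm_divide)
      also have "\<dots> \<le> norm z * \<bar>B\<bar> / norm (z ^ (n + 1) * F z)"
        using elim by (intro divide_right_mono mult_left_mono) auto
      also have "\<dots> = norm (z * of_real B / (z ^ (n + 1) * F z))"
        by (simp only: norm_mult norm_divide norm_of_real)
      finally show ?case .
    qed
    ultimately show ?thesis by (rule Lim_null_comparison[rotated])
  qed
  have S0: "S \<midarrow>0\<rightarrow> S 0"
    using analytic_at_imp_isCont[OF S_ana[of 0]] a(1) by (simp add: isCont_def)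
  have q0: "q \<midarrow>0\<rightarrow> - S 0"
    unfolding q_def using tendsto_diff[OF lim0 S0] by simp

  have lim_a: "\<exists>l. q \<midarrow>a k\<rightarrow> l" if k: "k \<le> n" for k
  proof -
    have ak: "a k \<notin> lat" using a(1) k by auto
    have F_ak: "F (a k) = 0" using F_eq_0[OF ak] k by (metis diff_self lat_simps(1))
    define Q where "Q = (\<lambda>z. c * (\<Prod>j\<in>{0..n} - {k}. \<sigma> (z - a j)) / \<sigma> z ^ (n + 1))"
    have "Q analytic_on {a k}"
      unfolding Q_def using ak analytic_sigma_shift[of 0]
      by (intro analytic_on_divide analytic_on_mult analytic_on_prod analytic_on_power analytic_on_const
          analytic_sigma_shift) (auto simp: sigma_eq_0_iff)
    then obtain Q' where Q': "(Q has_field_derivative Q') (at (a k))" by (meson analytic_derivI)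
    have "((\<lambda>z. \<sigma> (z - a k)) has_field_derivative 1) (at (a k))"
      using has_field_derivative_sigma_0 DERIV_shift[of \<sigma> 1 "a k" "- a k"] by simp
    from DERIV_mult'[OF this Q'] have "((\<lambda>z. \<sigma> (z - a k) * Q z) has_field_derivative Q (a k)) (at (a k))"
      by simp
    moreover have "\<forall>\<^sub>F z in nhds (a k). F z = \<sigma> (z - a k) * Q z"
    proof -
      have "(\<Prod>j=0..n. \<sigma> (z - a j)) = \<sigma> (z - a k) * (\<Prod>j\<in>{0..n} - {k}. \<sigma> (z - a j))" for z
        using k by (intro prod.remove) auto
      thus ?thesis using eventually_nhds_in_open[OF open_Compl_lat, of "a k"] ak
        by (auto elim!: eventually_mono simp: F Q_def)
    qed
    ultimately have "(F has_field_derivative Q (a k)) (at (a k))"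
      by (subst DERIV_cong_ev[OF refl _ refl])
    hence dF: "deriv F (a k) = D k" by (simp add: DERIV_imp_deriv Q_def D)
    have "D k \<noteq> 0" using c ak a(2) k by (auto simp: D sigma_eq_0_iff)
    with simple_zero_quotient_principal_part[OF F_ana(2)[OF ak] F_ana(1)[OF ak] F_ak]
    obtain l where l: "(\<lambda>z. G z / F z - (G (a k) / D k) / (z - a k)) \<midarrow>a k\<rightarrow> l"
      by (auto simp: dF)
    define S' where "S' = (\<lambda>z. \<Sum>j\<in>{1..n} - {k}. \<gamma> j * \<zeta> (z - a j))"
    have "S' analytic_on {a k}"
      unfolding S'_def
      by (intro analytic_on_sum analytic_on_mult analytic_on_const analytic_zeta_shift) (use k a(2) in auto)
    hence S': "S' \<midarrow>a k\<rightarrow> S' (a k)" using analytic_at_imp_isCont by (auto simp: isCont_def)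
    show ?thesis
    proof (cases "k = 0")
      case True
      hence "S' = S" "G (a k) / D k = 0" using G0 by (auto simp: S_def S'_def)
      thus ?thesis using tendsto_diff[OF l S'] by (auto simp: q_def)
    next
      case False
      hence S_eq: "S z = \<gamma> k * \<zeta> (z - a k) + S' z" for z
        using k unfolding S_def S'_def by (intro sum.remove) auto
      obtain l' where "(\<lambda>z. \<zeta> (z - a k) - 1 / (z - a k)) \<midarrow>a k\<rightarrow> l'"
        using zeta_principal_part by blast
      hence "(\<lambda>z. G z / F z - (G (a k) / D k) / (z - a k) - \<gamma> k * (\<zeta> (z - a k) - 1 / (z - a k)) - S' z)
               \<midarrow>a k\<rightarrow> l - \<gamma> k * l' - S' (a k)"
        by (intro tendsto_intros l S')
      moreover have "G z / F z - (G (a k) / D k) / (z - a k) - \<gamma> k * (\<zeta> (z - a k) - 1 / (z - a k)) - S' z = q z" for z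
        using \<gamma>[of k] False k by (simp add: q_def S_eq algebra_simps)
      ultimately show ?thesis by auto
    qed
  qed
  have sing: "\<exists>w\<in>lat. \<exists>l. q \<midarrow>p + w\<rightarrow> l" if p: "p \<notin> \<Omega>" for p
  proof (cases "p \<in> lat")
    case True
    thus ?thesis using q0 by (intro bexI[of _ "- p"]) auto
  next
    case False
    then obtain k where k: "k \<le> n" "p - a k \<in> lat" using p by (auto simp: in_\<Omega>)
    thus ?thesis using lim_a[OF k(1)] lat_diff_commute[of p "a k"]
      by (intro bexI[of _ "a k - p"]) auto
  qed

  have "\<forall>z\<in>\<Omega>. q (z + 1) = q z + b1" "\<forall>z\<in>\<Omega>. q (z + \<tau>) = q z + b2"
    "\<forall>p\<in>-\<Omega>. \<exists>w\<in>lat. \<exists>l. q \<midarrow>p + w\<rightarrow> l"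
    using q1 q2 sing by auto
  note g = remove_sings_entire_periods[OF \<Omega>1 \<Omega>2 q_holo \<Omega>_shift[OF lat_simps(2)]
      \<Omega>_shift[OF lat_simps(3)] this]
  note affine = entire_quasiperiodic_affine[OF g(1,2,3)]
  show "G z / F z = (\<Sum>j=1..n. \<gamma> j * (\<zeta> (z - a j) + \<zeta> (a j) - \<eta>1 * z))" if "z \<notin> lat" "F z \<noteq> 0" for z
  proof -
    have "z \<in> \<Omega>" using that F_eq_0[of z] by (auto simp: in_\<Omega>)
    have "q z = - S 0 + b1 * z" using affine(1)[of z] g(4)[OF \<open>z \<in> \<Omega>\<close>] g(5)[OF q0] by simp
    hence "G z / F z = S z - S 0 + b1 * z" by (simp add: q_def algebra_simps)
    also have "\<dots> = (\<Sum>j=1..n. \<gamma> j * (\<zeta> (z - a j) + \<zeta> (a j) - \<eta>1 * z))"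
      by (simp add: S_def b1_def zeta_minus distrib_left right_diff_distrib sum.distrib
            sum_subtractf sum_distrib_right sum_negf mult.assoc)
    finally show ?thesis .
  qed
  have "\<omega>' = (\<Sum>j=1..n. \<gamma> j) * (\<eta>1 * \<tau> - \<eta>2)"
    using affine(2) by (simp add: b1_def b2_def algebra_simps)
  thus "\<omega>' = 2 * of_real pi * \<i> * (\<Sum>j=1..n. \<gamma> j)" by (simp add: legendre_relation)
qed

end

section \<open>Families of elliptic functions with a single pole\<close>

text \<open>The parts of the hypotheses on \<open>f\<close> that the regularity of its parameter derivative rests on. The
  set \<open>\<Lambda> t\<close> is the moving lattice, \<open>U\<close> the complement of the poles in \<open>\<complex> \<times> I\<close>, and \<open>f'\<close> a total
  derivative of \<open>f\<close> on \<open>U\<close>, continuous in each direction.\<close>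
locale single_pole_family =
  fixes I :: "real set" and n :: nat and \<omega>2 :: "real \<Rightarrow> complex" and f :: "complex \<Rightarrow> real \<Rightarrow> complex"
    and f' :: "complex \<times> real \<Rightarrow> complex \<times> real \<Rightarrow> complex"
    and \<Lambda> :: "real \<Rightarrow> complex set" and U :: "(complex \<times> real) set"
  assumes interval: "is_interval I" "interior I \<noteq> {}"
    and n_pos: "n > 0"
    and Im_\<omega>2: "\<And>t. t \<in> I \<Longrightarrow> Im (\<omega>2 t) > 0"
    and cont_\<omega>2: "continuous_on I \<omega>2"
    and \<Lambda>_def: "\<And>t. \<Lambda> t = period_lattice 1 (\<omega>2 t)"
    and U_def: "U = {(z, t). t \<in> I \<and> z \<notin> \<Lambda> t}"
    and meromorphic: "\<And>t. t \<in> I \<Longrightarrow> (\<lambda>z. f z t) nicely_meromorphic_on UNIV"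
    and poles: "\<And>t z. t \<in> I \<Longrightarrow> is_pole (\<lambda>z. f z t) z \<longleftrightarrow> z \<in> \<Lambda> t"
    and order: "\<And>t. t \<in> I \<Longrightarrow> zorder (\<lambda>z. f z t) 0 = - int n"
    and has_derivative_f: "\<And>x. x \<in> U \<Longrightarrow> ((\<lambda>(z, t). f z t) has_derivative f' x) (at x within U)"
    and cont_f': "\<And>v. continuous_on U (\<lambda>x. f' x v)"
begin

definition f_t :: "real \<Rightarrow> complex \<Rightarrow> complex" where "f_t t z = f' (z, t) (0, 1)"

lemma lattice: "t \<in> I \<Longrightarrow> lattice_one_tau (\<omega>2 t)"
  using Im_\<omega>2 by unfold_locales

lemma in_U: "(z, t) \<in> U \<longleftrightarrow> t \<in> I \<and> z \<notin> \<Lambda> t"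
  by (simp add: U_def)

text \<open>A point lies in the moving lattice iff its two real coordinates with respect to \<open>1\<close> and \<open>\<omega>2 t\<close>
  are integers. These depend continuously on the point and the parameter, so \<open>U\<close> is relatively open
  as the preimage of an open set.\<close>
lemma U_nhd:
  assumes "t \<in> I" "z \<notin> \<Lambda> t"
  obtains e where "e > 0" "\<And>z' s. s \<in> I \<Longrightarrow> dist z' z < e \<Longrightarrow> dist s t < e \<Longrightarrow> z' \<notin> \<Lambda> s"
proof -
  define \<phi> where "\<phi> = (\<lambda>x :: complex \<times> real.
    (Re (fst x) - Im (fst x) / Im (\<omega>2 (snd x)) * Re (\<omega>2 (snd x)), Im (fst x) / Im (\<omega>2 (snd x))))"
  have "continuous_on (UNIV \<times> I) (\<lambda>x. \<omega>2 (snd x))"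
    by (rule continuous_on_compose2[OF cont_\<omega>2]) (auto intro!: continuous_intros)
  hence "continuous_on (UNIV \<times> I) \<phi>"
    unfolding \<phi>_def using Im_\<omega>2 by (intro continuous_intros) (auto simp: less_imp_neq[symmetric])
  moreover have "open (- (\<int> \<times> \<int> :: (real \<times> real) set))"
    by (intro open_Compl closed_Times closed_Ints)
  ultimately have "openin (top_of_set (UNIV \<times> I)) ((UNIV \<times> I) \<inter> \<phi> -` (- (\<int> \<times> \<int>)))"
    by (rule continuous_openin_preimage_gen)
  also have "(UNIV \<times> I) \<inter> \<phi> -` (- (\<int> \<times> \<int>)) = U"
    using lattice_one_tau.lat_iff_coords[OF lattice]
    by (auto simp: \<phi>_def U_def \<Lambda>_def)
  finally obtain e where e: "e > 0" "\<And>x. x \<in> UNIV \<times> I \<Longrightarrow> dist x (z, t) < e \<Longrightarrow> x \<in> U"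
    using assms unfolding openin_euclidean_subtopology_iff by (metis in_U)
  show ?thesis
  proof (rule that[of "e / 2"])
    fix z' s assume *: "s \<in> I" "dist z' z < e / 2" "dist s t < e / 2"
    have "dist (z', s) (z, t) \<le> dist z' z + dist s t"
      unfolding dist_Pair_Pair by (rule sqrt_sum_squares_le_sum) auto
    also have "\<dots> < e" using * by linarith
    finally show "z' \<notin> \<Lambda> s" using e(2)[of "(z', s)"] * by (auto simp: in_U)
  qed (use e in auto)
qed

lemma holomorphic_f: "t \<in> I \<Longrightarrow> (\<lambda>z. f z t) holomorphic_on - \<Lambda> t"
  by (rule analytic_imp_holomorphic, subst analytic_on_analytic_at)
     (use poles nicely_meromorphic_on_imp_analytic_at[OF meromorphic] in auto)

lemma open_Compl_\<Lambda>: "t \<in> I \<Longrightarrow> open (- \<Lambda> t)"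
  using lattice_one_tau.open_Compl_lat[OF lattice] by (simp add: \<Lambda>_def)

lemma islimpt_I:
  assumes "t \<in> I"
  shows "t islimpt I"
  using interval by (intro connected_imp_perfect is_interval_connected assms) auto

lemma at_within_I: "t \<in> I \<Longrightarrow> at t within I \<noteq> bot"
  using islimpt_I by (simp add: trivial_limit_within)

text \<open>The spatial part of the real total derivative is complex linear, being the derivative of the
  meromorphic function \<open>\<lambda>z. f z t\<close>.\<close>
lemma f'_split:
  assumes "t \<in> I" "z \<notin> \<Lambda> t"
  shows "f' (z, t) (v, r) = deriv (\<lambda>z. f z t) z * v + r *\<^sub>R f_t t z"
proof -
  have x: "(z, t) \<in> U" using assms by (simp add: in_U)
  interpret lin: bounded_linear "f' (z, t)" by (rule has_derivative_bounded_linear[OF has_derivative_f[OF x]])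
  have "((\<lambda>z. f z t) has_derivative (\<lambda>v. f' (z, t) (v, 0))) (at z)"
  proof -
    have "((\<lambda>(z, t). f z t) \<circ> (\<lambda>z. (z, t)) has_derivative f' (z, t) \<circ> (\<lambda>v. (v, 0))) (at z within - \<Lambda> t)"
    proof (rule diff_chain_within)
      show "((\<lambda>z. (z, t)) has_derivative (\<lambda>v. (v, 0))) (at z within - \<Lambda> t)"
        by (intro derivative_intros)
      show "((\<lambda>(z, t). f z t) has_derivative f' (z, t)) (at (z, t) within (\<lambda>z. (z, t)) ` (- \<Lambda> t))"
        by (rule has_derivative_subset[OF has_derivative_f[OF x]]) (use assms in \<open>auto simp: in_U\<close>)
    qed
    thus ?thesis using at_within_open[OF _ open_Compl_\<Lambda>] assms by (simp add: o_def)
  qed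
  moreover have "((\<lambda>z. f z t) has_derivative (\<lambda>v. deriv (\<lambda>z. f z t) z * v)) (at z)"
    using holomorphic_derivI[OF holomorphic_f open_Compl_\<Lambda>] assms
    by (auto simp: has_field_derivative_def)
  ultimately have "(\<lambda>v. f' (z, t) (v, 0)) = (\<lambda>v. deriv (\<lambda>z. f z t) z * v)"
    by (rule has_derivative_unique)
  moreover have "f' (z, t) (v, r) = f' (z, t) (v, 0) + r *\<^sub>R f' (z, t) (0, 1)"
    by (simp flip: lin.scaleR lin.add)
  ultimately show ?thesis by (metis f_t_def)
qed

text \<open>The one chain rule needed: a constant curve gives the parameter derivative, the curves
  \<open>z + \<omega>2 s\<close> the differentiated periodicity equation, and the critical points \<open>a k\<close> the derivatives
  of the critical values.\<close>
lemma curve_derivative: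
  assumes t: "t \<in> I" "\<phi> t \<notin> \<Lambda> t" and \<phi>: "(\<phi> has_vector_derivative \<phi>') (at t within I)"
  shows "((\<lambda>s. f (\<phi> s) s) has_vector_derivative deriv (\<lambda>z. f z t) (\<phi> t) * \<phi>' + f_t t (\<phi> t)) (at t within I)"
proof -
  obtain e where e: "e > 0" "\<And>z' s. s \<in> I \<Longrightarrow> dist z' (\<phi> t) < e \<Longrightarrow> dist s t < e \<Longrightarrow> z' \<notin> \<Lambda> s"
    using U_nhd[OF t] by metis
  have "\<forall>\<^sub>F s in at t within I. dist (\<phi> s) (\<phi> t) < e"
    using has_vector_derivative_continuous[OF \<phi>] e(1) by (auto simp: continuous_within tendsto_iff)
  then obtain d where d: "d > 0" "\<And>s. s \<in> I \<Longrightarrow> s \<noteq> t \<Longrightarrow> dist s t < d \<Longrightarrow> dist (\<phi> s) (\<phi> t) < e"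
    by (auto simp: eventually_at)
  define J where "J = I \<inter> ball t (min d e)"
  have J: "(\<phi> s, s) \<in> U" if "s \<in> J" for s
    using d(2)[of s] e(2)[of s "\<phi> s"] that e(1) unfolding in_U J_def
    by (cases "s = t") (auto simp: dist_commute t)
  have within: "at t within I = at t within J"
    by (rule at_within_nhd[of _ "ball t (min d e)"]) (use d e in \<open>auto simp: J_def\<close>)
  have "((\<lambda>(z, t). f z t) \<circ> (\<lambda>s. (\<phi> s, s)) has_derivative f' (\<phi> t, t) \<circ> (\<lambda>r. (r *\<^sub>R \<phi>', r))) (at t within J)"
  proof (rule diff_chain_within)
    show "((\<lambda>s. (\<phi> s, s)) has_derivative (\<lambda>r. (r *\<^sub>R \<phi>', r))) (at t within J)"
      using \<phi> unfolding within has_vector_derivative_def by (intro derivative_intros)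
    show "((\<lambda>(z, t). f z t) has_derivative f' (\<phi> t, t)) (at (\<phi> t, t) within (\<lambda>s. (\<phi> s, s)) ` J)"
      by (rule has_derivative_subset[OF has_derivative_f]) (use t J in \<open>auto simp: in_U\<close>)
  qed
  moreover have "f' (\<phi> t, t) \<circ> (\<lambda>r. (r *\<^sub>R \<phi>', r)) =
      (\<lambda>r. r *\<^sub>R (deriv (\<lambda>z. f z t) (\<phi> t) * \<phi>' + f_t t (\<phi> t)))"
    by (simp add: fun_eq_iff f'_split[OF t] scaleR_add_right)
  ultimately show ?thesis
    unfolding within has_vector_derivative_def by (simp add: o_def)
qed

lemma time_derivative:
  assumes "t \<in> I" "z \<notin> \<Lambda> t"
  shows "((\<lambda>s. f z s) has_vector_derivative f_t t z) (at t within I)"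
  using curve_derivative[of t "\<lambda>_. z" 0] assms by auto

lemma continuous_f_t:
  assumes "K \<subseteq> U"
  shows "continuous_on K (\<lambda>(z, t). f_t t z)"
  using continuous_on_subset[OF cont_f' assms, of "(0, 1)"] by (simp add: f_t_def case_prod_unfold)


text \<open>Compact pieces of \<open>I\<close> on which uniform continuity in the parameter is available; they are
  one-sided so that they exist at the end points of \<open>I\<close> too.\<close>
lemma segment_in_I:
  assumes "t \<in> I" "e > 0"
  obtains b where "b \<noteq> t" "closed_segment t b \<subseteq> I" "\<And>s. s \<in> closed_segment t b \<Longrightarrow> dist s t < e"
proof -
  obtain b where b: "b \<in> I" "b \<noteq> t" "dist b t < e"
    using islimpt_I[OF assms(1)] assms(2) unfolding islimpt_approachable by blast
  have "closed_segment t b \<subseteq> I"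
    using interval(1) assms(1) b(1) by (simp add: closed_segment_subset is_interval_convex_1)
  moreover have "dist s t < e" if "s \<in> closed_segment t b" for s
    using segment_bound(1)[OF that] b(3) by (simp add: dist_norm norm_minus_commute)
  ultimately show ?thesis by (rule that[OF b(2)])
qed

lemma at_within_segment: "b \<noteq> t \<Longrightarrow> at t within closed_segment t b \<noteq> bot" for b t :: real
  using connected_imp_perfect[of "closed_segment t b" t]
  by (auto simp: trivial_limit_within closed_segment_eq_sing dest: arg_cong[where f = "\<lambda>S. b \<in> S"])

lemma segment_time_derivative:
  assumes "closed_segment t b \<subseteq> I" "s \<in> closed_segment t b" "z \<notin> \<Lambda> s"
  shows "((\<lambda>s. f z s) has_vector_derivative f_t s z) (at s within closed_segment t b)"
  using time_derivative[of s z] assms by (blast intro: has_vector_derivative_within_subset)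

text \<open>The mean value inequality, with \<open>f_t\<close> uniformly continuous on the compact product of \<open>K\<close> and a
  segment of parameters.\<close>
lemma difference_quotients_converge:
  assumes J: "closed_segment t b \<subseteq> I" "b \<noteq> t" and K: "compact K" "K \<times> closed_segment t b \<subseteq> U"
  shows "uniform_limit K (\<lambda>s z. (f z s - f z t) / of_real (s - t)) (f_t t) (at t within closed_segment t b)"
proof (rule uniform_limitI)
  fix \<epsilon> :: real assume "\<epsilon> > 0"
  define J where "J = closed_segment t b"
  have "uniformly_continuous_on (K \<times> J) (\<lambda>(z, s). f_t s z)"
    using K unfolding J_def by (intro compact_uniformly_continuous continuous_f_t compact_Times) auto
  then obtain d where d: "d > 0"
    "\<And>x x'. x \<in> K \<times> J \<Longrightarrow> x' \<in> K \<times> J \<Longrightarrow> dist x' x < d \<Longrightarrow>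
       dist ((\<lambda>(z, s). f_t s z) x') ((\<lambda>(z, s). f_t s z) x) < \<epsilon> / 2"
    using \<open>\<epsilon> > 0\<close> unfolding uniformly_continuous_on_def by (metis half_gt_zero)
  have close: "norm (f_t s z - f_t t z) \<le> \<epsilon> / 2" if "z \<in> K" "s \<in> J" "dist s t < d" for s z
    using d(2)[of "(z, t)" "(z, s)"] that by (simp add: J_def dist_Pair_Pair) (simp add: dist_norm less_imp_le)
  have "\<forall>\<^sub>F s in at t within J. s \<in> J \<and> s \<noteq> t \<and> dist s t < d"
    using d(1) by (auto simp: eventually_at)
  thus "\<forall>\<^sub>F s in at t within closed_segment t b. \<forall>z\<in>K. dist ((f z s - f z t) / of_real (s - t)) (f_t t z) < \<epsilon>"
    unfolding J_def[symmetric]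
  proof (eventually_elim, intro ballI)
    case (elim s)
    fix z assume z: "z \<in> K"
    have seg: "closed_segment t s \<subseteq> J" using elim by (simp add: J_def closed_segment_subset)
    have "norm (f z s - f z t - (s - t) *\<^sub>R f_t t z) \<le> norm (s - t) * (\<epsilon> / 2)"
    proof (rule vector_differentiable_bound_linearization[where S = "closed_segment t s"])
      fix x assume x: "x \<in> closed_segment t s"
      have "dist x t < d" using segment_bound(1)[OF x] elim by (simp add: dist_norm norm_minus_commute)
      thus "norm (f_t x z - f_t t z) \<le> \<epsilon> / 2" using close[OF z, of x] x seg by blast
      show "((\<lambda>s. f z s) has_vector_derivative f_t x z) (at x within closed_segment t s)"
      proof (rule segment_time_derivative[OF _ x])
        show "closed_segment t s \<subseteq> I" using seg J by (simp add: J_def)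
        have "(z, x) \<in> U" using K(2) z x seg by (auto simp: J_def)
        thus "z \<notin> \<Lambda> x" by (simp add: in_U)
      qed
    qed auto
    moreover have "(f z s - f z t) / of_real (s - t) - f_t t z =
      (f z s - f z t - (s - t) *\<^sub>R f_t t z) / of_real (s - t)"
      using elim by (simp add: diff_divide_distrib scaleR_conv_of_real)
    ultimately have "norm ((f z s - f z t) / of_real (s - t) - f_t t z) \<le> \<epsilon> / 2"
      using elim by (simp add: norm_divide divide_le_eq mult.commute flip: of_real_diff)
    thus "dist ((f z s - f z t) / of_real (s - t)) (f_t t z) < \<epsilon>"
      using \<open>\<epsilon> > 0\<close> by (simp add: dist_norm)
  qed
qed

text \<open>A locally uniform limit of holomorphic difference quotients. All parameters are taken
  from one segment that starts at \<open>t\<close>, so that end points of \<open>I\<close> are covered as well.\<close>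
lemma holomorphic_f_t:
  assumes t: "t \<in> I"
  shows "f_t t holomorphic_on - \<Lambda> t"
  unfolding holomorphic_on_def
proof
  fix z assume "z \<in> - \<Lambda> t"
  then obtain e where e: "e > 0" "\<And>z' s. s \<in> I \<Longrightarrow> dist z' z < e \<Longrightarrow> dist s t < e \<Longrightarrow> z' \<notin> \<Lambda> s"
    using U_nhd[OF t] by (metis ComplD)
  obtain b where b: "b \<noteq> t" "closed_segment t b \<subseteq> I" "\<And>s. s \<in> closed_segment t b \<Longrightarrow> dist s t < e"
    using segment_in_I[OF t e(1)] by blast
  have K: "cball z (e / 2) \<times> closed_segment t b \<subseteq> U"
    using b e by (auto simp: in_U dist_commute)
  have "f_t t holomorphic_on ball z (e / 2)"
  proof (rule holomorphic_uniform_limit)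
    show "uniform_limit (cball z (e / 2)) (\<lambda>s z. (f z s - f z t) / of_real (s - t)) (f_t t)
            (at t within closed_segment t b)"
      by (rule difference_quotients_converge[OF b(2,1) compact_cball K])
    have "t \<in> closed_segment t b" by simp
    have h: "(\<lambda>z. f z s) holomorphic_on cball z (e / 2)" if "s \<in> closed_segment t b" for s
      by (rule holomorphic_on_subset[OF holomorphic_f]) (use that b K in \<open>auto simp: in_U\<close>)
    have "\<forall>\<^sub>F s in at t within closed_segment t b. s \<in> closed_segment t b \<and> s \<noteq> t"
      by (auto simp: eventually_at intro: exI[of _ 1])
    thus "\<forall>\<^sub>F s in at t within closed_segment t b.
       continuous_on (cball z (e / 2)) (\<lambda>z. (f z s - f z t) / of_real (s - t)) \<and>
       (\<lambda>z. (f z s - f z t) / of_real (s - t)) holomorphic_on ball z (e / 2)"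
    proof eventually_elim
      case (elim s)
      have "(\<lambda>z. (f z s - f z t) / of_real (s - t)) holomorphic_on cball z (e / 2)"
        using elim by (intro holomorphic_intros h) auto
      thus ?case
        by (meson ball_subset_cball holomorphic_on_imp_continuous_on holomorphic_on_subset)
    qed
    show "at t within closed_segment t b \<noteq> bot"
      using b(1) by (rule at_within_segment)
  qed
  hence "f_t t field_differentiable at z"
    using e(1) by (meson centre_in_ball half_gt_zero holomorphic_on_imp_differentiable_at open_ball)
  thus "f_t t field_differentiable at z within - \<Lambda> t" by (rule field_differentiable_at_within)
qed

lemma open_Compl_\<Lambda>_0: "t \<in> I \<Longrightarrow> open (- (\<Lambda> t - {0}))"
  unfolding \<Lambda>_def by (intro open_Compl lattice_one_tau.closed_subset_lat[OF lattice]) auto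

lemma pole_factor_limit:
  assumes "t \<in> I"
  shows "\<exists>l. (\<lambda>z. z ^ n * f z t) \<midarrow>0\<rightarrow> l"
proof -
  define g where "g = zor_poly (\<lambda>z. f z t) 0"
  have "0 \<in> \<Lambda> t"
    unfolding \<Lambda>_def by (rule lattice_one_tau.lat_simps(1)[OF lattice[OF assms]])
  hence pole: "is_pole (\<lambda>z. f z t) 0" using poles[OF assms] by simp
  have holo: "(\<lambda>z. f z t) holomorphic_on - (\<Lambda> t - {0}) - {0}"
    by (rule holomorphic_on_subset[OF holomorphic_f[OF assms]]) (use \<open>0 \<in> \<Lambda> t\<close> in auto)
  have "\<exists>r. r > 0 \<and> cball 0 r \<subseteq> - (\<Lambda> t - {0}) \<and> g holomorphic_on cball 0 r \<and>
     (\<forall>w\<in>cball 0 r - {0}. f w t = g w / (w - 0) ^ nat (- zorder (\<lambda>z. f z t) 0) \<and> g w \<noteq> 0)"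
    unfolding g_def using zorder_exist_pole[OF holo open_Compl_\<Lambda>_0[OF assms] _ pole] by simp
  then obtain r where r: "r > 0" "g holomorphic_on cball 0 r"
    "\<And>w. w \<in> cball 0 r - {0} \<Longrightarrow> f w t = g w / w ^ n"
    by (auto simp: order[OF assms])
  have "isCont g 0"
    using holomorphic_on_imp_continuous_on[OF r(2)] r(1)
    by (simp add: continuous_on_interior)
  hence "g \<midarrow>0\<rightarrow> g 0" by (simp add: isCont_def)
  moreover have "\<forall>\<^sub>F w in at 0. g w = w ^ n * f w t"
    using eventually_at_in_open[of "ball 0 r" 0] r(1)
    by (auto elim!: eventually_mono simp: r(3))
  ultimately show ?thesis by (blast intro: Lim_transform_eventually)
qed

text \<open>On a small circle the difference quotients of \<open>f\<close> in \<open>t\<close> are bounded because they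
  converge uniformly. Multiplied by \<open>z ^ n\<close> they extend holomorphically to the disc, and the maximum
  modulus principle carries the bound inside, from where it passes to the limit.\<close>
lemma pole_order_f_t:
  assumes t: "t \<in> I"
  shows "\<exists>B. \<forall>\<^sub>F z in at 0. norm (z ^ n * f_t t z) \<le> B"
proof -
  define T where "T = Im (\<omega>2 t)"
  have T: "T > 0" using Im_\<omega>2[OF t] by (simp add: T_def)
  \<comment> \<open>For parameters near \<open>t\<close> the imaginary part of \<open>\<omega>2\<close> exceeds \<open>T / 2\<close>, so the disc of radius \<open>r\<close> meets no nonzero lattice point.\<close>
  define r where "r = min (1 / 2) (T / 4)"
  have r: "r > 0" "r \<le> 1 / 2" "r \<le> T / 4" using T by (auto simp: r_def)
  obtain e where e: "e > 0" "\<And>s. s \<in> I \<Longrightarrow> dist s t < e \<Longrightarrow> dist (\<omega>2 s) (\<omega>2 t) < T / 2"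
    using cont_\<omega>2 t T unfolding continuous_on_iff by (metis half_gt_zero)
  have small: "z = 0" if z: "z \<in> \<Lambda> s" "norm z \<le> r" and s: "s \<in> I" "dist s t < e" for z s
  proof -
    obtain k m :: int where km: "z = of_int k + of_int m * \<omega>2 s"
      using z(1) lattice_one_tau.lat_iff[OF lattice[OF s(1)]] by (auto simp: \<Lambda>_def)
    have "T / 2 < Im (\<omega>2 s)"
      using e(2)[OF s] abs_Im_le_cmod[of "\<omega>2 s - \<omega>2 t"] by (simp add: dist_norm T_def)
    have "\<bar>real_of_int m\<bar> * (T / 2) \<le> \<bar>real_of_int m\<bar> * Im (\<omega>2 s)"
      using \<open>T / 2 < Im (\<omega>2 s)\<close> by (intro mult_left_mono) auto
    also have "\<dots> = \<bar>Im z\<bar>" using Im_\<omega>2[OF s(1)] by (simp add: km abs_mult)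
    also have "\<dots> \<le> norm z" by (rule abs_Im_le_cmod)
    also have "\<dots> < 1 * (T / 2)" using z(2) r T by linarith
    finally have "\<bar>real_of_int m\<bar> < 1" using T by (simp only: mult_less_cancel_right_pos half_gt_zero)
    hence "m = 0" by linarith
    hence "\<bar>real_of_int k\<bar> < 1" using km z(2) r by simp
    hence "k = 0" by linarith
    thus ?thesis using km \<open>m = 0\<close> by simp
  qed
  obtain b where b: "b \<noteq> t" "closed_segment t b \<subseteq> I" "\<And>s. s \<in> closed_segment t b \<Longrightarrow> dist s t < e"
    using segment_in_I[OF t e(1)] by blast
  define J where "J = closed_segment t b"
  have J: "s \<in> I" "dist s t < e" if "s \<in> J" for s using b that by (auto simp: J_def)
  have notin: "z \<notin> \<Lambda> s" if "norm z \<le> r" "z \<noteq> 0" "s \<in> J" for z s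
    using small[OF _ that(1) J] that by blast
  define Q where "Q = (\<lambda>s z. (f z s - f z t) / of_real (s - t))"
  have Q_lim: "uniform_limit K Q (f_t t) (at t within J)"
    if "compact K" "\<And>z. z \<in> K \<Longrightarrow> norm z \<le> r \<and> z \<noteq> 0" for K
    unfolding Q_def J_def
    by (rule difference_quotients_converge[OF b(2,1) that(1)])
       (use that(2) notin J in \<open>auto simp: in_U J_def\<close>)
  have tJ: "t \<in> J" by (simp add: J_def)
  have J_bot: "at t within J \<noteq> bot"
    using b(1) unfolding J_def by (rule at_within_segment)

  have "continuous_on (sphere 0 r) (f_t t)"
    by (rule holomorphic_on_imp_continuous_on, rule holomorphic_on_subset[OF holomorphic_f_t[OF t]])
       (use notin[OF _ _ tJ] r in auto)
  hence "bounded (f_t t ` sphere 0 r)" by (intro compact_imp_bounded compact_continuous_image) auto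
  then obtain M where M: "\<And>z. z \<in> sphere 0 r \<Longrightarrow> norm (f_t t z) \<le> M"
    unfolding bounded_iff by blast
  have circle: "\<forall>\<^sub>F s in at t within J. \<forall>z\<in>sphere 0 r. norm (Q s z) \<le> M + 1"
  proof -
    have "uniform_limit (sphere 0 r) Q (f_t t) (at t within J)"
      by (rule Q_lim) (use r in auto)
    hence "\<forall>\<^sub>F s in at t within J. \<forall>z\<in>sphere 0 r. dist (Q s z) (f_t t z) < 1"
      by (rule uniform_limitD) simp
    thus ?thesis
    proof eventually_elim
      case (elim s)
      show ?case
      proof
        fix z :: complex assume z: "z \<in> sphere 0 r"
        have "norm (Q s z) \<le> norm (f_t t z) + norm (Q s z - f_t t z)" by (rule norm_triangle_sub)
        thus "norm (Q s z) \<le> M + 1" using M[OF z] elim z by (fastforce simp: dist_norm)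
      qed
    qed
  qed
  have disc: "\<forall>\<^sub>F s in at t within J. \<forall>z. 0 < norm z \<and> norm z < r \<longrightarrow> norm (z ^ n * Q s z) \<le> r ^ n * (M + 1)"
  proof -
    have "\<forall>\<^sub>F s in at t within J. s \<in> J" by (auto simp: eventually_at intro: exI[of _ 1])
    with circle show ?thesis
    proof eventually_elim
      case (elim s)
      define W where "W = - (\<Lambda> s - {0}) \<inter> - (\<Lambda> t - {0})"
      have W: "open W" unfolding W_def
        by (intro open_Int open_Compl_\<Lambda>_0 t J(1)[OF elim(2)])
      have W_cball: "cball 0 r \<subseteq> W"
        using notin[OF _ _ tJ] notin[OF _ _ elim(2)] by (auto simp: W_def)
      obtain l l' where l: "(\<lambda>z. z ^ n * f z s) \<midarrow>0\<rightarrow> l" "(\<lambda>z. z ^ n * f z t) \<midarrow>0\<rightarrow> l'"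
        using pole_factor_limit[OF t] pole_factor_limit[OF J(1)[OF elim(2)]] by blast
      define L where "L = (l - l') * inverse (of_real (s - t))"
      have "(\<lambda>z. (z ^ n * f z s - z ^ n * f z t) * inverse (of_real (s - t))) \<midarrow>0\<rightarrow> L"
        unfolding L_def by (intro tendsto_intros l)
      hence lim: "(\<lambda>z. z ^ n * Q s z) \<midarrow>0\<rightarrow> L"
        by (simp add: Q_def field_simps)
      define h where "h = (\<lambda>z. if z = 0 then L else z ^ n * Q s z)"
      have "0 \<in> \<Lambda> s" if "s \<in> J" for s
        unfolding \<Lambda>_def by (rule lattice_one_tau.lat_simps(1)[OF lattice[OF J(1)[OF that]]])
      hence "W - {0} \<subseteq> - \<Lambda> s" "W - {0} \<subseteq> - \<Lambda> t" by (auto simp: W_def)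
      hence "(\<lambda>z. f z s) holomorphic_on W - {0}" "(\<lambda>z. f z t) holomorphic_on W - {0}"
        using holomorphic_f[OF J(1)[OF elim(2)]] holomorphic_f[OF t] holomorphic_on_subset by blast+
      hence "(\<lambda>z. z ^ n * (inverse (of_real (s - t)) * (f z s - f z t))) holomorphic_on W - {0}"
        by (intro holomorphic_intros)
      hence "(\<lambda>z. z ^ n * Q s z) holomorphic_on W - {0}"
        by (simp add: Q_def divide_inverse mult.commute)
      hence h: "h holomorphic_on W"
        unfolding h_def by (rule removable_singularity[OF _ W lim])
      show ?case
      proof (intro allI impI)
        fix z :: complex assume z: "0 < norm z \<and> norm z < r"
        have "norm (h z) \<le> r ^ n * (M + 1)"
        proof (rule maximum_modulus_frontier[of h "cball 0 r"])
          show "h holomorphic_on interior (cball 0 r)" "continuous_on (closure (cball 0 r)) h"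
            using holomorphic_on_subset[OF h W_cball]
            by (auto intro: holomorphic_on_imp_continuous_on holomorphic_on_subset[of h "cball 0 r"])
          show "norm (h x) \<le> r ^ n * (M + 1)" if "x \<in> frontier (cball 0 r)" for x
          proof -
            have x: "norm x = r" "x \<in> sphere 0 r" "x \<noteq> 0" using that r(1) by auto
            have "norm (x ^ n * Q s x) = r ^ n * norm (Q s x)" using x by (simp add: norm_mult norm_power)
            also have "\<dots> \<le> r ^ n * (M + 1)" using elim(1) x r by (intro mult_left_mono) auto
            finally show ?thesis using x by (simp add: h_def)
          qed
        qed (use z in auto)
        thus "norm (z ^ n * Q s z) \<le> r ^ n * (M + 1)" using z by (auto simp: h_def)
      qed
    qed
  qed
  have "norm (z ^ n * f_t t z) \<le> r ^ n * (M + 1)" if z: "0 < norm z" "norm z < r" for z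
  proof (rule tendsto_upperbound[OF _ _ J_bot])
    have "((\<lambda>s. Q s z) \<longlongrightarrow> f_t t z) (at t within J)"
      by (rule tendsto_uniform_limitI[OF Q_lim[of "{z}"]]) (use z in auto)
    thus "((\<lambda>s. norm (z ^ n * Q s z)) \<longlongrightarrow> norm (z ^ n * f_t t z)) (at t within J)"
      by (intro tendsto_intros)
    show "\<forall>\<^sub>F s in at t within J. norm (z ^ n * Q s z) \<le> r ^ n * (M + 1)"
      using disc by eventually_elim (use z in auto)
  qed
  hence "\<forall>\<^sub>F z in at 0. norm (z ^ n * f_t t z) \<le> r ^ n * (M + 1)"
    using r(1) by (auto simp: eventually_at intro!: exI[of _ r])
  thus ?thesis by blast
qed

end

section \<open>The differential equation\<close>

lemma (in lattice_one_tau) parallelogram_Int_lat: "z \<in> period_parallelogram 1 \<tau> \<and> z \<in> lat \<longleftrightarrow> z = 0"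
proof
  assume z: "z \<in> period_parallelogram 1 \<tau> \<and> z \<in> lat"
  then obtain x y where xy: "z = of_real x + of_real y * \<tau>" "0 \<le> x" "x < 1" "0 \<le> y" "y < 1"
    by (auto simp: period_parallelogram_def)
  hence "x \<in> \<int>" "y \<in> \<int>" using z of_real_coords_in_lat_iff by auto
  hence "x = 0" "y = 0" using xy by (auto elim!: Ints_cases)
  thus "z = 0" by (simp add: xy)
next
  assume "z = 0"
  thus "z \<in> period_parallelogram 1 \<tau> \<and> z \<in> lat"
    by (auto simp: period_parallelogram_def intro!: exI[of _ "0::real"])
qed

lemma smooth_on_imp_C1:
  assumes "smooth_on g S"
  obtains g' where "\<And>x. x \<in> S \<Longrightarrow> (g has_derivative g' x) (at x within S)"
    "\<And>v. continuous_on S (\<lambda>x. g' x v)"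
proof -
  have "Ck_on (Suc 0) g S" using assms unfolding smooth_on_def by blast
  thus ?thesis using that by (auto simp: Ball_def)
qed

lemma smooth_on_imp_has_vector_derivative:
  fixes g :: "real \<Rightarrow> 'a :: real_normed_vector"
  assumes "smooth_on g S" "t \<in> S"
  obtains g' where "(g has_vector_derivative g') (at t within S)"
proof -
  obtain g' where "(g has_derivative g' t) (at t within S)"
    using smooth_on_imp_C1[OF assms(1)] assms(2) by metis
  hence "g differentiable (at t within S)" by (rule differentiableI)
  thus ?thesis using that vector_derivative_works by blast
qed

theorem mainTheorem3:
  fixes I :: "real set" and n :: nat
    and \<omega>1 \<omega>2 c :: "real \<Rightarrow> complex"
    and f h :: "complex \<Rightarrow> real \<Rightarrow> complex"
    and a A D \<gamma> :: "nat \<Rightarrow> real \<Rightarrow> complex"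
  assumes interval: "is_interval I" "interior I \<noteq> {}"
    and n: "n \<ge> 2"
    and periods: "\<forall>t\<in>I. \<omega>1 t = 1" "\<forall>t\<in>I. Im (\<omega>2 t) > 0"
    and elliptic: "\<forall>t\<in>I. elliptic (\<omega>1 t) (\<omega>2 t) (\<lambda>z. f z t)"
    and order: "\<forall>t\<in>I. elliptic_order (\<omega>1 t) (\<omega>2 t) (\<lambda>z. f z t) = n"
    and poles: "\<forall>t\<in>I. \<forall>z. is_pole (\<lambda>z. f z t) z \<longleftrightarrow> z \<in> period_lattice (\<omega>1 t) (\<omega>2 t)"
    and smooth_\<omega>2: "smooth_on \<omega>2 I"
    and smooth_f: "smooth_on (\<lambda>(z, t). f z t)
                     {(z, t). t \<in> I \<and> z \<notin> period_lattice (\<omega>1 t) (\<omega>2 t)}"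
    and smooth_a: "\<forall>k\<le>n. smooth_on (a k) I"
    and simple: "\<forall>t\<in>I. \<forall>z. critical_point (\<lambda>z. f z t) z \<longrightarrow> simple_critical_point (\<lambda>z. f z t) z"
    and critical: "\<forall>t\<in>I. \<forall>k\<le>n. critical_point (\<lambda>z. f z t) (a k t)"
    and complete: "\<forall>t\<in>I. \<forall>z. critical_point (\<lambda>z. f z t) z \<longrightarrow>
                     (\<exists>!k. k \<le> n \<and> z - a k t \<in> period_lattice (\<omega>1 t) (\<omega>2 t))"
    and sum_a: "\<forall>t\<in>I. (\<Sum>k=0..n. a k t) = 0"
    and c_nonzero: "\<forall>t\<in>I. c t \<noteq> 0"
    and deriv_f: "\<forall>t\<in>I. \<forall>z. z \<notin> period_lattice (\<omega>1 t) (\<omega>2 t) \<longrightarrow>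
                    deriv (\<lambda>z. f z t) z =
                      c t * (\<Prod>k=0..n. weierstrass_sigma (\<omega>1 t) (\<omega>2 t) (z - a k t))
                        / weierstrass_sigma (\<omega>1 t) (\<omega>2 t) z ^ (n + 1)"
    and A: "\<And>k t. A k t = f (a k t) t"
    and A0: "\<forall>t\<in>I. A 0 t = 0"
    and D: "\<And>k t. D k t =
              c t * (\<Prod>j\<in>{0..n} - {k}. weierstrass_sigma (\<omega>1 t) (\<omega>2 t) (a k t - a j t))
                / weierstrass_sigma (\<omega>1 t) (\<omega>2 t) (a k t) ^ (n + 1)"
    and \<gamma>: "\<And>k t. \<gamma> k t = vector_derivative (A k) (at t within I) / D k t"
    and h: "\<And>z t. h z t =
              (\<Sum>j=1..n. \<gamma> j t * (weierstrass_zeta (\<omega>1 t) (\<omega>2 t) (z - a j t)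
                                + weierstrass_zeta (\<omega>1 t) (\<omega>2 t) (a j t)
                                - weierstrass_eta1 (\<omega>1 t) (\<omega>2 t) * z))"
  shows "(\<forall>t\<in>I. \<forall>z. z \<notin> period_lattice (\<omega>1 t) (\<omega>2 t) \<and> deriv (\<lambda>z. f z t) z \<noteq> 0 \<longrightarrow>
            vector_derivative (\<lambda>s. f z s) (at t within I) / deriv (\<lambda>z. f z t) z = h z t)
       \<and> (\<forall>t\<in>I. \<omega>1 t = 1)
       \<and> (\<forall>t\<in>I. (\<omega>2 has_vector_derivative 2 * of_real pi * \<i> * (\<Sum>j=1..n. \<gamma> j t)) (at t within I))"
proof -
  define \<Lambda> where "\<Lambda> = (\<lambda>t. period_lattice 1 (\<omega>2 t))"
  define U where "U = {(z, t). t \<in> I \<and> z \<notin> \<Lambda> t}"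
  have \<omega>1: "\<omega>1 t = 1" if "t \<in> I" for t using periods(1) that by blast
  have U_eq: "{(z, t). t \<in> I \<and> z \<notin> period_lattice (\<omega>1 t) (\<omega>2 t)} = U"
    by (auto simp: U_def \<Lambda>_def \<omega>1)
  obtain f' where f': "\<And>x. x \<in> U \<Longrightarrow> ((\<lambda>(z, t). f z t) has_derivative f' x) (at x within U)"
    "\<And>v. continuous_on U (\<lambda>x. f' x v)"
    using smooth_on_imp_C1[OF smooth_f] unfolding U_eq by metis
  have cont_\<omega>2: "continuous_on I \<omega>2"
    using smooth_\<omega>2 unfolding smooth_on_def by (metis Ck_on.simps(1))
  have lat: "lattice_one_tau (\<omega>2 t)" if "t \<in> I" for t
    using periods(2) that by unfold_locales auto
  have ell: "(\<lambda>z. f z t) nicely_meromorphic_on UNIV" "\<And>z. f (z + 1) t = f z t"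
    "\<And>z. f (z + \<omega>2 t) t = f z t" if "t \<in> I" for t
    using elliptic that \<omega>1[OF that] by (auto simp: elliptic_def)
  have pole_iff: "is_pole (\<lambda>z. f z t) z \<longleftrightarrow> z \<in> \<Lambda> t" if "t \<in> I" for t z
    using poles that \<omega>1[OF that] by (simp add: \<Lambda>_def)
  have zorder_f: "zorder (\<lambda>z. f z t) 0 = - int n" if t: "t \<in> I" for t
  proof -
    have "{z. z \<in> period_parallelogram 1 (\<omega>2 t) \<and> is_pole (\<lambda>z. f z t) z} = {0}"
      using lattice_one_tau.parallelogram_Int_lat[OF lat[OF t]] pole_iff[OF t] by (auto simp: \<Lambda>_def)
    hence "nat (- zorder (\<lambda>z. f z t) 0) = n"
      using order t \<omega>1[OF t] by (auto simp: elliptic_order_def)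
    thus ?thesis using n by linarith
  qed
  interpret single_pole_family I n \<omega>2 f f' \<Lambda> U
    by unfold_locales
       (use interval n periods(2) cont_\<omega>2 ell(1) pole_iff zorder_f f' in \<open>auto simp: \<Lambda>_def U_def\<close>)

  have main: "(\<forall>z. z \<notin> \<Lambda> t \<and> deriv (\<lambda>z. f z t) z \<noteq> 0 \<longrightarrow>
                 f_t t z / deriv (\<lambda>z. f z t) z = h z t) \<and>
              (\<omega>2 has_vector_derivative 2 * of_real pi * \<i> * (\<Sum>j=1..n. \<gamma> j t)) (at t within I)"
    if t: "t \<in> I" for t
  proof -
    interpret lattice_one_tau "\<omega>2 t" by (rule lat[OF t])
    define F where "F = deriv (\<lambda>z. f z t)"
    have \<Lambda>t: "\<Lambda> t = lat" by (simp add: \<Lambda>_def)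
    obtain \<omega>' where \<omega>': "(\<omega>2 has_vector_derivative \<omega>') (at t within I)"
      using smooth_on_imp_has_vector_derivative[OF smooth_\<omega>2 t] .
    have crit: "a k t \<notin> \<Lambda> t" "F (a k t) = 0" if "k \<le> n" for k
      using critical t that pole_iff[OF t] by (auto simp: critical_point_def F_def)
    have unique: "a k t - a j t \<notin> lat" if "j \<le> n" "k \<le> n" "j \<noteq> k" for j k
    proof
      assume "a k t - a j t \<in> lat"
      moreover have "a k t - a k t \<in> lat" by simp
      moreover have "critical_point (\<lambda>z. f z t) (a k t)" using critical t that by blast
      ultimately show False using complete t that \<omega>1[OF t] by metis
    qed
    have DF: "((\<lambda>z. f z t) has_field_derivative F z) (at z)" if "z \<notin> \<Lambda> t" for z
      unfolding F_def using holomorphic_derivI[OF holomorphic_f[OF t] open_Compl_\<Lambda>[OF t]] that by auto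
    have F_per: "F (z + v) = F z" if "\<And>z. f (z + v) t = f z t" "z + v \<notin> \<Lambda> t" "z \<notin> \<Lambda> t" for z v
    proof (rule DERIV_unique)
      show "((\<lambda>z. f z t) has_field_derivative F z) (at z)" by (rule DF[OF that(3)])
      have "((\<lambda>z. f (z + v) t) has_field_derivative F (z + v)) (at z)"
        using DF[OF that(2)] by (simp add: DERIV_shift)
      thus "((\<lambda>z. f z t) has_field_derivative F (z + v)) (at z)" by (simp add: that(1))
    qed
    have A': "(A k has_vector_derivative f_t t (a k t)) (at t within I)" if k: "k \<le> n" for k
    proof -
      obtain a' where "(a k has_vector_derivative a') (at t within I)"
        using smooth_on_imp_has_vector_derivative smooth_a k t by blast
      from curve_derivative[OF t _ this] crit[OF k] show ?thesis
        by (simp add: F_def A[abs_def])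
    qed
    have A'_eq: "vector_derivative (A k) (at t within I) = f_t t (a k t)" if "k \<le> n" for k
      by (rule vector_derivative_within[OF at_within_I[OF t] A'[OF that]])
    have eq: "x = y" if "(g has_vector_derivative x) (at t within I)" "(g' has_vector_derivative y) (at t within I)"
      "\<And>s. s \<in> I \<Longrightarrow> g s = g' s" for g g' :: "real \<Rightarrow> complex" and x y
      using vector_derivative_unique_within[OF at_within_I[OF t] that(1)]
        has_vector_derivative_transform[OF t that(3) that(2)] by blast
    have "f_t t (a 0 t) = 0"
      by (rule eq[OF A'[of 0] has_vector_derivative_const]) (use A0 in auto)
    moreover have "f_t t (z + 1) = f_t t z" if "z \<notin> lat" for z
      by (rule eq[OF time_derivative[OF t] time_derivative[OF t]]) (use that ell(2) \<Lambda>t in auto)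
    moreover have "f_t t (z + \<omega>2 t) + \<omega>' * F z = f_t t z" if z: "z \<notin> lat" for z
    proof (rule eq)
      have "((\<lambda>s. f (z + \<omega>2 s) s) has_vector_derivative F (z + \<omega>2 t) * (0 + \<omega>') + f_t t (z + \<omega>2 t)) (at t within I)"
        unfolding F_def
      proof (rule curve_derivative[OF t])
        show "((\<lambda>s. z + \<omega>2 s) has_vector_derivative 0 + \<omega>') (at t within I)"
          by (intro has_vector_derivative_add has_vector_derivative_const \<omega>')
      qed (use z \<Lambda>t in simp)
      moreover have "F (z + \<omega>2 t) = F z" using F_per[OF ell(3)[OF t]] z \<Lambda>t by simp
      ultimately show "((\<lambda>s. f (z + \<omega>2 s) s) has_vector_derivative f_t t (z + \<omega>2 t) + \<omega>' * F z) (at t within I)"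
        by (simp add: add.commute mult.commute)
      show "((\<lambda>s. f z s) has_vector_derivative f_t t z) (at t within I)"
        using time_derivative[OF t] z \<Lambda>t by simp
    qed (use ell(3) in auto)
    moreover obtain B where "\<forall>\<^sub>F z in at 0. norm (z ^ n * f_t t z) \<le> B"
      using pole_order_f_t[OF t] by blast
    moreover have "F z = c t * (\<Prod>k=0..n. \<sigma> (z - a k t)) / \<sigma> z ^ (n + 1)" if "z \<notin> lat" for z
      using bspec[OF deriv_f t, unfolded \<omega>1[OF t]] that unfolding F_def by blast
    moreover have "D k t = c t * (\<Prod>j\<in>{0..n} - {k}. \<sigma> (a k t - a j t)) / \<sigma> (a k t) ^ (n + 1)" for k
      using D[of k t] \<omega>1[OF t] by simp
    moreover have "\<gamma> k t = f_t t (a k t) / D k t" if "k \<le> n" for k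
      using \<gamma>[of k t] A'_eq[OF that] by simp
    moreover have "f_t t holomorphic_on - lat" using holomorphic_f_t[OF t] by (simp add: \<Lambda>t)
    ultimately have "\<And>z. z \<notin> lat \<Longrightarrow> F z \<noteq> 0 \<Longrightarrow> f_t t z / F z =
        (\<Sum>j=1..n. \<gamma> j t * (\<zeta> (z - a j t) + \<zeta> (a j t) - \<eta>1 * z))"
      and "\<omega>' = 2 * of_real pi * \<i> * (\<Sum>j=1..n. \<gamma> j t)"
      using quotient_eq_zeta_sum[where F = F and G = "f_t t" and c = "c t" and a = "\<lambda>k. a k t"
          and D = "\<lambda>k. D k t" and \<gamma> = "\<lambda>k. \<gamma> k t" and n = n and B = B and \<omega>' = \<omega>']
        c_nonzero t crit(1) unique F_per[OF ell(2)[OF t]] F_per[OF ell(3)[OF t]] \<Lambda>t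
      by auto
    thus ?thesis using \<omega>' h[of _ t] \<omega>1[OF t] \<Lambda>t by (simp add: F_def)
  qed
  have "vector_derivative (\<lambda>s. f z s) (at t within I) = f_t t z" if "t \<in> I" "z \<notin> \<Lambda> t" for t z
    using time_derivative[OF that] at_within_I[OF that(1)] by (intro vector_derivative_within)
  thus ?thesis using main \<omega>1 by (auto simp: \<Lambda>_def)
qed

end
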